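(* Let $R$ be a commutative ring with unity such that $R = 2R$, and let $I$ be an ideal of $R$. Let $(P, \langle\ ,\ \rangle)$ be a symplectic $R$-module with $P$ a finitely generated projective $R$-module of rank $2n$, $n \geq 1$, and let $Q = R^2 \oplus P$ with the form induced from $\mathbb{H}(R) \oplus P$. Assume that for every maximal ideal $\mathfrak{m}$ of $R$, over the local ring $R_{\mathfrak{m}}$, the alternating form $\langle\ ,\ \rangle$ corresponds (with respect to some basis of $P_{\mathfrak m}$) to an alternating matrix $\varphi_{\mathfrak{m}}$ of Pfaffian $1$ with $\varphi_{\mathfrak{m}} \equiv \psi_n \pmod{I}$. Then $\operatorname{ETrans}_{\operatorname{Sp}}(Q, IQ, \langle\ ,\ \rangle)$ is a normal subgroup of $\operatorname{Sp}(Q)$.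
   Context: A symplectic $R$-module is a pair $(P,\langle\ ,\ \rangle)$ where $P$ is a finitely generated projective $R$-module of even rank and $\langle\ ,\ \rangle: P\times P\to R$ is an alternating bilinear form that is non-degenerate, i.e. $x\mapsto \langle x,-\rangle$ is an isomorphism $P\cong P^{*}=\operatorname{Hom}_R(P,R)$. An isometry of a symplectic module is an $R$-linear automorphism preserving the form; $\operatorname{Sp}(P)$ denotes the group of isometries of $(P,\langle\ ,\ \rangle)$. $\mathbb{H}(R)=R\oplus R^{*}$ carries the form $\langle (a_1,f_1),(a_2,f_2)\rangle = f_2(a_1)-f_1(a_2)$. $Q=R^2\oplus P$ is given the orthogonal sum form of $\mathbb{H}(R)\oplus P$ (identifying $R^*$ with $R$), so $\langle (a,b,p),(c,d,r)\rangle = ad-bc+\langle p,r\rangle$; this makes $Q$ a symplectic $R$-module. For $q\in P$ and $\alpha,\beta\in R$, the elementary symplectic transvections of $Q$ are the isometries $$\rho(q,\alpha): (a,b,p)\mapsto (a,\ b-\langle p,q\rangle-\alpha a,\ p-aq),$$ $$\mu(q,\beta): (a,b,p)\mapsto (a+\langle p,q\rangle+\beta b,\ b,\ p-bq).$$ $\operatorname{ETrans}_{\operatorname{Sp}}(Q,\langle\ ,\ \rangle)$ is the subgroup of $\operatorname{Sp}(Q)$ generated by all of these. $\operatorname{ETrans}_{\operatorname{Sp}}(IQ,\langle\ ,\ \rangle)$ is the subgroup generated by those $\rho(q,\alpha)$, $\mu(q,\beta)$ with $q\in IP$ and $\alpha,\beta\in I$. $\operatorname{ETrans}_{\operatorname{Sp}}(Q,IQ,\langle\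 ,\ \rangle)$ is the normal closure of $\operatorname{ETrans}_{\operatorname{Sp}}(IQ,\langle\ ,\ \rangle)$ in $\operatorname{ETrans}_{\operatorname{Sp}}(Q,\langle\ ,\ \rangle)$. A form on a free module with basis $e_1,\dots,e_{2n}$ corresponds to the matrix $\varphi$ if $\langle p,q\rangle=p^{\top}\varphi q$ in coordinates. $\psi_n=\sum_{i=1}^{n}e_{2i-1,2i}-\sum_{i=1}^{n}e_{2i,2i-1}$ is the standard alternating $2n\times 2n$ matrix ($e_{ij}$ being matrix units). Over $R_{\mathfrak m}$, congruence modulo $I$ means entrywise congruence modulo the extended ideal $I_{\mathfrak m}=IR_{\mathfrak m}$. *)

theory Defs
  imports "HOL-Algebra.Algebra" "HOL-Combinatorics.Permutations"
begin

section \<open>Modules\<close>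

text \<open>The record of modules extends the record of rings; the fields \<open>mult\<close> and \<open>one\<close> of a module
  play no role in the locale \<^locale>\<open>module\<close> and are left unspecified below.
  Maps between modules are taken to be extensional, as in \<^const>\<open>BijGroup\<close>.\<close>

definition module_hom ::
  "('a, 'm) ring_scheme \<Rightarrow> ('a, 'b, 'k) module_scheme \<Rightarrow> ('a, 'c, 'l) module_scheme \<Rightarrow> ('b \<Rightarrow> 'c) set"
  where "module_hom R M N = {f \<in> carrier M \<rightarrow>\<^sub>E carrier N.
    (\<forall>x\<in>carrier M. \<forall>y\<in>carrier M. f (x \<oplus>\<^bsub>M\<^esub> y) = f x \<oplus>\<^bsub>N\<^esub> f y) \<and>
    (\<forall>a\<in>carrier R. \<forall>x\<in>carrier M. f (a \<odot>\<^bsub>M\<^esub> x) = a \<odot>\<^bsub>N\<^esub> f x)}"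

definition module_iso ::
  "('a, 'm) ring_scheme \<Rightarrow> ('a, 'b, 'k) module_scheme \<Rightarrow> ('a, 'c, 'l) module_scheme \<Rightarrow> ('b \<Rightarrow> 'c) set"
  where "module_iso R M N = {f \<in> module_hom R M N. bij_betw f (carrier M) (carrier N)}"

definition regular_module :: "('a, 'm) ring_scheme \<Rightarrow> ('a, 'a) module"
  where "regular_module R =
    \<lparr>carrier = carrier R, monoid.mult = undefined, monoid.one = undefined,
     ring.zero = \<zero>\<^bsub>R\<^esub>, ring.add = (\<oplus>\<^bsub>R\<^esub>), module.smult = (\<otimes>\<^bsub>R\<^esub>)\<rparr>"

definition dual_module ::
  "('a, 'm) ring_scheme \<Rightarrow> ('a, 'b, 'k) module_scheme \<Rightarrow> ('a, 'b \<Rightarrow> 'a) module"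
  where "dual_module R M =
    \<lparr>carrier = module_hom R M (regular_module R), monoid.mult = undefined, monoid.one = undefined,
     ring.zero = (\<lambda>x\<in>carrier M. \<zero>\<^bsub>R\<^esub>),
     ring.add = (\<lambda>f g. \<lambda>x\<in>carrier M. f x \<oplus>\<^bsub>R\<^esub> g x),
     module.smult = (\<lambda>a f. \<lambda>x\<in>carrier M. a \<otimes>\<^bsub>R\<^esub> f x)\<rparr>"

definition direct_sum ::
  "('a, 'b, 'k) module_scheme \<Rightarrow> ('a, 'c, 'l) module_scheme \<Rightarrow> ('a, 'b \<times> 'c) module"
  where "direct_sum M N =
    \<lparr>carrier = carrier M \<times> carrier N, monoid.mult = undefined, monoid.one = undefined,
     ring.zero = (\<zero>\<^bsub>M\<^esub>, \<zero>\<^bsub>N\<^esub>),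
     ring.add = (\<lambda>(x, y) (x', y'). (x \<oplus>\<^bsub>M\<^esub> x', y \<oplus>\<^bsub>N\<^esub> y')),
     module.smult = (\<lambda>a (x, y). (a \<odot>\<^bsub>M\<^esub> x, a \<odot>\<^bsub>N\<^esub> y))\<rparr>"

text \<open>The free module \<open>R^(T)\<close> of finitely supported functions.\<close>

definition free_module :: "('a, 'm) ring_scheme \<Rightarrow> 'c set \<Rightarrow> ('a, 'c \<Rightarrow> 'a) module"
  where "free_module R T =
    \<lparr>carrier = {f \<in> T \<rightarrow>\<^sub>E carrier R. finite {x \<in> T. f x \<noteq> \<zero>\<^bsub>R\<^esub>}},
     monoid.mult = undefined, monoid.one = undefined,
     ring.zero = (\<lambda>x\<in>T. \<zero>\<^bsub>R\<^esub>),
     ring.add = (\<lambda>f g. \<lambda>x\<in>T. f x \<oplus>\<^bsub>R\<^esub> g x),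
     module.smult = (\<lambda>a f. \<lambda>x\<in>T. a \<otimes>\<^bsub>R\<^esub> f x)\<rparr>"

definition module_span ::
  "('a, 'm) ring_scheme \<Rightarrow> ('a, 'b, 'k) module_scheme \<Rightarrow> 'b set \<Rightarrow> 'b set"
  where "module_span R M A = \<Inter>{H. submodule H R M \<and> A \<subseteq> H}"

definition finitely_generated :: "('a, 'm) ring_scheme \<Rightarrow> ('a, 'b, 'k) module_scheme \<Rightarrow> bool"
  where "finitely_generated R M \<longleftrightarrow>
    (\<exists>A. finite A \<and> A \<subseteq> carrier M \<and> module_span R M A = carrier M)"

text \<open>A module is projective if it is a direct summand of a free module. Restricting the index set
  to the type \<open>'b\<close> of the elements of the module is harmless: if there is any such
  decomposition, then the kernel of the canonical surjection from the free module on
  \<^term>\<open>carrier M\<close> is a possible complement.\<close>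

definition projective :: "('a, 'm) ring_scheme \<Rightarrow> ('a, 'b, 'k) module_scheme \<Rightarrow> bool"
  where "projective R M \<longleftrightarrow>
    (\<exists>(T :: 'b set) (N :: ('a, 'b \<Rightarrow> 'a) module).
       module R N \<and> module_iso R (direct_sum M N) (free_module R T) \<noteq> {})"

definition lin_comb :: "('a, 'b, 'k) module_scheme \<Rightarrow> nat \<Rightarrow> (nat \<Rightarrow> 'b) \<Rightarrow> (nat \<Rightarrow> 'a) \<Rightarrow> 'b"
  where "lin_comb M r b c = (\<Oplus>\<^bsub>M\<^esub>i\<in>{..<r}. c i \<odot>\<^bsub>M\<^esub> b i)"

definition module_basis ::
  "('a, 'm) ring_scheme \<Rightarrow> ('a, 'b, 'k) module_scheme \<Rightarrow> nat \<Rightarrow> (nat \<Rightarrow> 'b) \<Rightarrow> bool"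
  where "module_basis R M r b \<longleftrightarrow> b \<in> {..<r} \<rightarrow> carrier M \<and>
    (\<forall>x\<in>carrier M. \<exists>!c. c \<in> {..<r} \<rightarrow>\<^sub>E carrier R \<and> x = lin_comb M r b c)"

definition ideal_mult_module ::
  "('a, 'm) ring_scheme \<Rightarrow> 'a set \<Rightarrow> ('a, 'b, 'k) module_scheme \<Rightarrow> 'b set"
  where "ideal_mult_module R I M = module_span R M {a \<odot>\<^bsub>M\<^esub> x | a x. a \<in> I \<and> x \<in> carrier M}"


section \<open>Localization\<close>

text \<open>\<open>loc_frac R S M x s\<close> is the fraction \<open>x/s\<close>, i.e. the class of \<open>(x, s)\<close>. The operations on classes
  are independent of the chosen representatives, so that each of the unions below is a union of
  copies of one and the same class.\<close>

definition loc_rel ::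
  "('a, 'm) ring_scheme \<Rightarrow> 'a set \<Rightarrow> ('a, 'b, 'k) module_scheme \<Rightarrow> (('b \<times> 'a) \<times> ('b \<times> 'a)) set"
  where "loc_rel R S M = {((x, s), (y, t)).
    x \<in> carrier M \<and> s \<in> S \<and> y \<in> carrier M \<and> t \<in> S \<and>
    (\<exists>u\<in>S. u \<odot>\<^bsub>M\<^esub> (t \<odot>\<^bsub>M\<^esub> x) = u \<odot>\<^bsub>M\<^esub> (s \<odot>\<^bsub>M\<^esub> y))}"

definition loc_frac ::
  "('a, 'm) ring_scheme \<Rightarrow> 'a set \<Rightarrow> ('a, 'b, 'k) module_scheme \<Rightarrow> 'b \<Rightarrow> 'a \<Rightarrow> ('b \<times> 'a) set"
  where "loc_frac R S M x s = loc_rel R S M `` {(x, s)}"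

definition loc_module ::
  "('a, 'm) ring_scheme \<Rightarrow> 'a set \<Rightarrow> ('a, 'b, 'k) module_scheme \<Rightarrow> (('a \<times> 'a) set, ('b \<times> 'a) set) module"
  where "loc_module R S M =
    \<lparr>carrier = (carrier M \<times> S) // loc_rel R S M, monoid.mult = undefined, monoid.one = undefined,
     ring.zero = loc_frac R S M \<zero>\<^bsub>M\<^esub> \<one>\<^bsub>R\<^esub>,
     ring.add = (\<lambda>U V. \<Union>(x, s)\<in>U. \<Union>(y, t)\<in>V.
              loc_frac R S M (t \<odot>\<^bsub>M\<^esub> x \<oplus>\<^bsub>M\<^esub> s \<odot>\<^bsub>M\<^esub> y) (s \<otimes>\<^bsub>R\<^esub> t)),
     module.smult = (\<lambda>A U. \<Union>(a, s)\<in>A. \<Union>(x, t)\<in>U. loc_frac R S M (a \<odot>\<^bsub>M\<^esub> x) (s \<otimes>\<^bsub>R\<^esub> t))\<rparr>"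

definition loc_ring :: "('a, 'm) ring_scheme \<Rightarrow> 'a set \<Rightarrow> ('a \<times> 'a) set ring"
  where "loc_ring R S =
    (let L = loc_module R S (regular_module R) in
    \<lparr>carrier = carrier L, monoid.mult = module.smult L,
     monoid.one = loc_frac R S (regular_module R) \<one>\<^bsub>R\<^esub> \<one>\<^bsub>R\<^esub>,
     ring.zero = ring.zero L, ring.add = ring.add L\<rparr>)"

text \<open>Localization at a prime ideal \<open>p\<close>; the form induced on the localized module is
  \<open>\<langle>x/s, y/t\<rangle> = \<langle>x, y\<rangle>/(st)\<close>.\<close>

definition ring_at :: "('a, 'm) ring_scheme \<Rightarrow> 'a set \<Rightarrow> ('a \<times> 'a) set ring"
  where "ring_at R p = loc_ring R (carrier R - p)"

definition module_at ::
  "('a, 'm) ring_scheme \<Rightarrow> 'a set \<Rightarrow> ('a, 'b, 'k) module_scheme \<Rightarrow> (('a \<times> 'a) set, ('b \<times> 'a) set) module"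
  where "module_at R p M = loc_module R (carrier R - p) M"

definition form_at ::
  "('a, 'm) ring_scheme \<Rightarrow> 'a set \<Rightarrow> ('b \<Rightarrow> 'b \<Rightarrow> 'a) \<Rightarrow> ('b \<times> 'a) set \<Rightarrow> ('b \<times> 'a) set \<Rightarrow> ('a \<times> 'a) set"
  where "form_at R p B U V = (\<Union>(x, s)\<in>U. \<Union>(y, t)\<in>V.
    loc_frac R (carrier R - p) (regular_module R) (B x y) (s \<otimes>\<^bsub>R\<^esub> t))"

definition ideal_at :: "('a, 'm) ring_scheme \<Rightarrow> 'a set \<Rightarrow> 'a set \<Rightarrow> ('a \<times> 'a) set set"
  where "ideal_at R p I =
    Idl\<^bsub>ring_at R p\<^esub> ((\<lambda>a. loc_frac R (carrier R - p) (regular_module R) a \<one>\<^bsub>R\<^esub>) ` I)"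

definition has_rank :: "('a, 'm) ring_scheme \<Rightarrow> ('a, 'b, 'k) module_scheme \<Rightarrow> nat \<Rightarrow> bool"
  where "has_rank R M r \<longleftrightarrow>
    (\<forall>p. primeideal p R \<longrightarrow> (\<exists>b. module_basis (ring_at R p) (module_at R p M) r b))"

text \<open>The rank of a projective module may vary with the prime.\<close>

definition has_even_rank :: "('a, 'm) ring_scheme \<Rightarrow> ('a, 'b, 'k) module_scheme \<Rightarrow> bool"
  where "has_even_rank R M \<longleftrightarrow>
    (\<forall>p. primeideal p R \<longrightarrow> (\<exists>k b. module_basis (ring_at R p) (module_at R p M) (2 * k) b))"


section \<open>Symplectic modules\<close>

definition bilinear_form ::
  "('a, 'm) ring_scheme \<Rightarrow> ('a, 'b, 'k) module_scheme \<Rightarrow> ('b \<Rightarrow> 'b \<Rightarrow> 'a) \<Rightarrow> bool"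
  where "bilinear_form R M B \<longleftrightarrow>
    (\<forall>x\<in>carrier M. (\<lambda>y\<in>carrier M. B x y) \<in> module_hom R M (regular_module R)) \<and>
    (\<forall>y\<in>carrier M. (\<lambda>x\<in>carrier M. B x y) \<in> module_hom R M (regular_module R))"

definition alternating_form ::
  "('a, 'm) ring_scheme \<Rightarrow> ('a, 'b, 'k) module_scheme \<Rightarrow> ('b \<Rightarrow> 'b \<Rightarrow> 'a) \<Rightarrow> bool"
  where "alternating_form R M B \<longleftrightarrow> bilinear_form R M B \<and> (\<forall>x\<in>carrier M. B x x = \<zero>\<^bsub>R\<^esub>)"

definition nondegenerate_form ::
  "('a, 'm) ring_scheme \<Rightarrow> ('a, 'b, 'k) module_scheme \<Rightarrow> ('b \<Rightarrow> 'b \<Rightarrow> 'a) \<Rightarrow> bool"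
  where "nondegenerate_form R M B \<longleftrightarrow>
    (\<lambda>x\<in>carrier M. \<lambda>y\<in>carrier M. B x y) \<in> module_iso R M (dual_module R M)"

definition symplectic_module ::
  "('a, 'm) ring_scheme \<Rightarrow> ('a, 'b, 'k) module_scheme \<Rightarrow> ('b \<Rightarrow> 'b \<Rightarrow> 'a) \<Rightarrow> bool"
  where "symplectic_module R P B \<longleftrightarrow>
    module R P \<and> finitely_generated R P \<and> projective R P \<and> has_even_rank R P \<and>
    alternating_form R P B \<and> nondegenerate_form R P B"

definition Sp ::
  "('a, 'm) ring_scheme \<Rightarrow> ('a, 'b, 'k) module_scheme \<Rightarrow> ('b \<Rightarrow> 'b \<Rightarrow> 'a) \<Rightarrow> ('b \<Rightarrow> 'b) monoid"
  where "Sp R P B = (BijGroup (carrier P))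
    \<lparr>carrier := {f \<in> module_iso R P P. \<forall>x\<in>carrier P. \<forall>y\<in>carrier P. B (f x) (f y) = B x y}\<rparr>"

text \<open>\<open>Q = R \<oplus> R \<oplus> P\<close> with the form \<open>\<langle>(a, b, p), (c, d, r)\<rangle> = ad - bc + \<langle>p, r\<rangle>\<close>.\<close>

definition hyp_module ::
  "('a, 'm) ring_scheme \<Rightarrow> ('a, 'b, 'k) module_scheme \<Rightarrow> ('a, 'a \<times> 'a \<times> 'b) module"
  where "hyp_module R P = direct_sum (regular_module R) (direct_sum (regular_module R) P)"

definition hyp_form ::
  "('a, 'm) ring_scheme \<Rightarrow> ('b \<Rightarrow> 'b \<Rightarrow> 'a) \<Rightarrow> 'a \<times> 'a \<times> 'b \<Rightarrow> 'a \<times> 'a \<times> 'b \<Rightarrow> 'a"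
  where "hyp_form R B = (\<lambda>(a, b, p) (c, d, r).
    (a \<otimes>\<^bsub>R\<^esub> d \<ominus>\<^bsub>R\<^esub> b \<otimes>\<^bsub>R\<^esub> c) \<oplus>\<^bsub>R\<^esub> B p r)"

abbreviation Sp_hyp ::
  "('a, 'm) ring_scheme \<Rightarrow> ('a, 'b, 'k) module_scheme \<Rightarrow> ('b \<Rightarrow> 'b \<Rightarrow> 'a) \<Rightarrow>
    ('a \<times> 'a \<times> 'b \<Rightarrow> 'a \<times> 'a \<times> 'b) monoid"
  where "Sp_hyp R P B \<equiv> Sp R (hyp_module R P) (hyp_form R B)"


section \<open>Elementary symplectic transvections\<close>

definition transv_rho ::
  "('a, 'm) ring_scheme \<Rightarrow> ('a, 'b, 'k) module_scheme \<Rightarrow> ('b \<Rightarrow> 'b \<Rightarrow> 'a) \<Rightarrow> 'b \<Rightarrow> 'a \<Rightarrow>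
    'a \<times> 'a \<times> 'b \<Rightarrow> 'a \<times> 'a \<times> 'b"
  where "transv_rho R P B q \<alpha> = (\<lambda>(a, b, p)\<in>carrier (hyp_module R P).
    (a, b \<ominus>\<^bsub>R\<^esub> B p q \<ominus>\<^bsub>R\<^esub> \<alpha> \<otimes>\<^bsub>R\<^esub> a, p \<ominus>\<^bsub>P\<^esub> a \<odot>\<^bsub>P\<^esub> q))"

definition transv_mu ::
  "('a, 'm) ring_scheme \<Rightarrow> ('a, 'b, 'k) module_scheme \<Rightarrow> ('b \<Rightarrow> 'b \<Rightarrow> 'a) \<Rightarrow> 'b \<Rightarrow> 'a \<Rightarrow>
    'a \<times> 'a \<times> 'b \<Rightarrow> 'a \<times> 'a \<times> 'b"
  where "transv_mu R P B q \<beta> = (\<lambda>(a, b, p)\<in>carrier (hyp_module R P).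
    (a \<oplus>\<^bsub>R\<^esub> B p q \<oplus>\<^bsub>R\<^esub> \<beta> \<otimes>\<^bsub>R\<^esub> b, b, p \<ominus>\<^bsub>P\<^esub> b \<odot>\<^bsub>P\<^esub> q))"

text \<open>\<open>ETrans R P B\<close> is \<open>ETrans\<^sub>S\<^sub>p(Q)\<close>, \<open>ETrans_ideal R P B I\<close> is \<open>ETrans\<^sub>S\<^sub>p(IQ)\<close> and
  \<open>ETrans_rel R P B I\<close> is \<open>ETrans\<^sub>S\<^sub>p(Q, IQ)\<close>, where \<open>Q = R\<^sup>2 \<oplus> P\<close>.\<close>

definition ETrans ::
  "('a, 'm) ring_scheme \<Rightarrow> ('a, 'b, 'k) module_scheme \<Rightarrow> ('b \<Rightarrow> 'b \<Rightarrow> 'a) \<Rightarrow>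
    ('a \<times> 'a \<times> 'b \<Rightarrow> 'a \<times> 'a \<times> 'b) set"
  where "ETrans R P B = generate (Sp_hyp R P B)
    ({transv_rho R P B q \<alpha> | q \<alpha>. q \<in> carrier P \<and> \<alpha> \<in> carrier R} \<union>
     {transv_mu R P B q \<beta> | q \<beta>. q \<in> carrier P \<and> \<beta> \<in> carrier R})"

definition ETrans_ideal ::
  "('a, 'm) ring_scheme \<Rightarrow> ('a, 'b, 'k) module_scheme \<Rightarrow> ('b \<Rightarrow> 'b \<Rightarrow> 'a) \<Rightarrow> 'a set \<Rightarrow>
    ('a \<times> 'a \<times> 'b \<Rightarrow> 'a \<times> 'a \<times> 'b) set"
  where "ETrans_ideal R P B I = generate (Sp_hyp R P B)
    ({transv_rho R P B q \<alpha> | q \<alpha>. q \<in> ideal_mult_module R I P \<and> \<alpha> \<in> I} \<union>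
     {transv_mu R P B q \<beta> | q \<beta>. q \<in> ideal_mult_module R I P \<and> \<beta> \<in> I})"

definition normal_closure :: "('g, 'm) monoid_scheme \<Rightarrow> 'g set \<Rightarrow> 'g set"
  where "normal_closure G H = \<Inter>{N. N \<lhd> G \<and> H \<subseteq> N}"

definition ETrans_rel ::
  "('a, 'm) ring_scheme \<Rightarrow> ('a, 'b, 'k) module_scheme \<Rightarrow> ('b \<Rightarrow> 'b \<Rightarrow> 'a) \<Rightarrow> 'a set \<Rightarrow>
    ('a \<times> 'a \<times> 'b \<Rightarrow> 'a \<times> 'a \<times> 'b) set"
  where "ETrans_rel R P B I =
    normal_closure ((Sp_hyp R P B)\<lparr>carrier := ETrans R P B\<rparr>) (ETrans_ideal R P B I)"


section \<open>Alternating matrices\<close>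

text \<open>An \<open>r \<times> r\<close> matrix is a function of two indices, both starting from 0, of which only the values
  at indices below \<open>r\<close> matter.\<close>

definition alternating_matrix :: "('a, 'm) ring_scheme \<Rightarrow> nat \<Rightarrow> (nat \<Rightarrow> nat \<Rightarrow> 'a) \<Rightarrow> bool"
  where "alternating_matrix R r \<phi> \<longleftrightarrow>
    (\<forall>i<r. \<forall>j<r. \<phi> i j \<in> carrier R \<and> \<phi> i j = \<ominus>\<^bsub>R\<^esub> \<phi> j i) \<and> (\<forall>i<r. \<phi> i i = \<zero>\<^bsub>R\<^esub>)"

definition std_alt_matrix :: "('a, 'm) ring_scheme \<Rightarrow> nat \<Rightarrow> nat \<Rightarrow> 'a"
  where "std_alt_matrix R i j =
    (if even i \<and> j = i + 1 then \<one>\<^bsub>R\<^esub> else if even j \<and> i = j + 1 then \<ominus>\<^bsub>R\<^esub> \<one>\<^bsub>R\<^esub> else \<zero>\<^bsub>R\<^esub>)"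

text \<open>The perfect matchings of \<open>{0, \<dots>, 2n - 1}\<close>: \<open>\<sigma>\<close> stands for the matching with the edges
  \<open>{\<sigma> (2 i), \<sigma> (2 i + 1)}\<close>, each written in increasing order and sorted by their least elements.\<close>

definition perfect_matchings :: "nat \<Rightarrow> (nat \<Rightarrow> nat) set"
  where "perfect_matchings n = {\<sigma>. \<sigma> permutes {..<2 * n} \<and>
    (\<forall>i<n. \<sigma> (2 * i) < \<sigma> (2 * i + 1)) \<and>
    (\<forall>i j. i < j \<and> j < n \<longrightarrow> \<sigma> (2 * i) < \<sigma> (2 * j))}"

definition pfaffian :: "('a, 'm) ring_scheme \<Rightarrow> nat \<Rightarrow> (nat \<Rightarrow> nat \<Rightarrow> 'a) \<Rightarrow> 'a"
  where "pfaffian R n \<phi> = (\<Oplus>\<^bsub>R\<^esub>\<sigma>\<in>perfect_matchings n.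
    (if evenperm \<sigma> then \<one>\<^bsub>R\<^esub> else \<ominus>\<^bsub>R\<^esub> \<one>\<^bsub>R\<^esub>) \<otimes>\<^bsub>R\<^esub>
    (\<Otimes>\<^bsub>R\<^esub>i\<in>{..<n}. \<phi> (\<sigma> (2 * i)) (\<sigma> (2 * i + 1))))"

definition form_matrix ::
  "('a, 'm) ring_scheme \<Rightarrow> ('a, 'b, 'k) module_scheme \<Rightarrow> ('b \<Rightarrow> 'b \<Rightarrow> 'a) \<Rightarrow> nat \<Rightarrow> (nat \<Rightarrow> 'b) \<Rightarrow>
    (nat \<Rightarrow> nat \<Rightarrow> 'a) \<Rightarrow> bool"
  where "form_matrix R M B r b \<phi> \<longleftrightarrow>
    (\<forall>c \<in> {..<r} \<rightarrow> carrier R. \<forall>d \<in> {..<r} \<rightarrow> carrier R.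
       B (lin_comb M r b c) (lin_comb M r b d) =
       (\<Oplus>\<^bsub>R\<^esub>i\<in>{..<r}. \<Oplus>\<^bsub>R\<^esub>j\<in>{..<r}. c i \<otimes>\<^bsub>R\<^esub> \<phi> i j \<otimes>\<^bsub>R\<^esub> d j))"

definition matrix_cong ::
  "('a, 'm) ring_scheme \<Rightarrow> 'a set \<Rightarrow> nat \<Rightarrow> (nat \<Rightarrow> nat \<Rightarrow> 'a) \<Rightarrow> (nat \<Rightarrow> nat \<Rightarrow> 'a) \<Rightarrow> bool"
  where "matrix_cong R J r \<phi> \<psi> \<longleftrightarrow> (\<forall>i<r. \<forall>j<r. \<phi> i j \<ominus>\<^bsub>R\<^esub> \<psi> i j \<in> J)"

end

theory Submission
  imports Defs
begin

text \<open>
  Let \<open>h\<close> be the inverse of 2. For orthogonal vectors \<open>u\<close>, \<open>w\<close> of \<open>Q\<close> the map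
  \<open>T(u, w): v \<mapsto> v + \<langle>u, v\<rangle> w + \<langle>w, v\<rangle> u\<close> is an isometry. It is symmetric in \<open>u\<close> and \<open>w\<close>, scalars can
  be moved from one argument to the other, \<open>g T(u, w) g\<inverse> = T(g u, g w)\<close> for every isometry \<open>g\<close>, and
  \<open>T(u, w) T(u, w') = T(u, w + w' + h \<langle>w, w'\<rangle> u)\<close>. With \<open>e = (1, 0, 0)\<close> and \<open>f = (0, 1, 0)\<close>, the
  transvections \<open>\<rho>(q, \<alpha>)\<close> and \<open>\<mu>(q, \<beta>)\<close> are \<open>T(f, q + h \<alpha> f)\<close> and \<open>T(e, h \<beta> e - q)\<close>. A conjugate of a
  generator of the relative group under an arbitrary isometry is therefore some \<open>T(u, w)\<close>, where \<open>u\<close>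
  belongs to a hyperbolic pair and \<open>w\<close> is an \<open>I\<close>-combination of vectors orthogonal to \<open>u\<close>; it has to be
  shown that these lie in \<open>N = ETrans\<^sub>S\<^sub>p(Q, IQ)\<close>. For \<open>I = R\<close> this says that \<open>E = ETrans\<^sub>S\<^sub>p(Q)\<close> is normal
  in \<open>Sp(Q)\<close>, and then the conjugate of \<open>N\<close> by an isometry is again normal in \<open>E\<close>, so that it is
  enough to conjugate the generators of \<open>N\<close>.

  Fix \<open>u\<close>. By the product formula, the \<open>w\<close> with \<open>T(u, r w) \<in> N\<close> for all \<open>r\<close> form a submodule of the
  orthogonal complement of \<open>u\<close> (\<open>submodule_transvec_lines\<close>). If \<open>q \<in> IP\<close>, then \<open>T(q, v) \<in> N\<close> for every
  \<open>v\<close> orthogonal to \<open>q\<close>: for \<open>v \<in> P\<close> it is the commutator of \<open>T(e, q)\<close> and \<open>T(f, v)\<close>, and for \<open>v = e\<close> and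
  \<open>v = f\<close> it is a generator (\<open>core_transvec_lines\<close>). Conjugation by \<open>\<gamma> \<in> E\<close> shows that the submodule contains
  all \<open>\<gamma> q\<close> with \<open>q \<in> IP\<close> that are orthogonal to \<open>u\<close> (\<open>transvec_lines_conj\<close>).

  It remains to see that the complement of \<open>u\<close> is spanned by the vectors \<open>\<gamma> q\<close>, \<open>q \<in> P\<close>, which it contains.
  It consists of the values of the alternating map \<open>(x, y) \<mapsto> \<langle>y, u\<rangle> x + \<langle>u, x\<rangle> y\<close> on \<open>Q\<close>, and for \<open>x, y\<close> in one and
  the same \<open>\<gamma> P\<close> the value is of the required form. Comparing several \<open>\<gamma>\<close>, the span is seen to contain
  \<open>\<langle>x, y\<rangle>\<^sup>2 w\<close> for all \<open>x, y \<in> P\<close> and all \<open>w\<close> in the complement (\<open>wedge_span\<close>). The scalars \<open>\<langle>x, y\<rangle>\<^sup>2\<close> generate the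
  unit ideal: a Pfaffian equal to 1 in the local ring at a maximal ideal \<open>\<mm>\<close> has an entry outside of
  the maximal ideal of that ring, so that \<open>\<langle>x, y\<rangle> \<notin> \<mm>\<close> for some \<open>x, y \<in> P\<close>
  (\<open>ex_form_value_notin_prime\<close>).
\<close>

section \<open>Transvections of an alternating space\<close>

locale alternating_space = module R M for R (structure) and M (structure) +
  fixes B :: "'c \<Rightarrow> 'c \<Rightarrow> 'a" and h :: 'a
  assumes alternating: "alternating_form R M B"
    and half_closed [simp]: "h \<in> carrier R"
    and half: "h \<oplus> h = \<one>"
begin

lemma bilinear: "bilinear_form R M B"
  using alternating by (simp add: alternating_form_def)

lemma form_closed [simp]: "x \<in> carrier M \<Longrightarrow> y \<in> carrier M \<Longrightarrow> B x y \<in> carrier R"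
  using bilinear unfolding bilinear_form_def module_hom_def regular_module_def
  by (auto dest!: bspec[of _ _ x] simp: restrict_PiE_iff)

lemma form_add_left:
  "x \<in> carrier M \<Longrightarrow> x' \<in> carrier M \<Longrightarrow> y \<in> carrier M \<Longrightarrow> B (x \<oplus>\<^bsub>M\<^esub> x') y = B x y \<oplus> B x' y"
  using bilinear unfolding bilinear_form_def module_hom_def regular_module_def by simp

lemma form_add_right:
  "x \<in> carrier M \<Longrightarrow> y \<in> carrier M \<Longrightarrow> y' \<in> carrier M \<Longrightarrow> B x (y \<oplus>\<^bsub>M\<^esub> y') = B x y \<oplus> B x y'"
  using bilinear unfolding bilinear_form_def module_hom_def regular_module_def by simp

lemma form_smult_left:
  "a \<in> carrier R \<Longrightarrow> x \<in> carrier M \<Longrightarrow> y \<in> carrier M \<Longrightarrow> B (a \<odot>\<^bsub>M\<^esub> x) y = a \<otimes> B x y"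
  using bilinear unfolding bilinear_form_def module_hom_def regular_module_def by simp

lemma form_smult_right:
  "a \<in> carrier R \<Longrightarrow> x \<in> carrier M \<Longrightarrow> y \<in> carrier M \<Longrightarrow> B x (a \<odot>\<^bsub>M\<^esub> y) = a \<otimes> B x y"
  using bilinear unfolding bilinear_form_def module_hom_def regular_module_def by simp

lemma form_self [simp]: "x \<in> carrier M \<Longrightarrow> B x x = \<zero>"
  using alternating by (simp add: alternating_form_def)

lemma form_skew: "x \<in> carrier M \<Longrightarrow> y \<in> carrier M \<Longrightarrow> B y x = \<ominus> B x y"
proof -
  assume xy: "x \<in> carrier M" "y \<in> carrier M"
  have "B (x \<oplus>\<^bsub>M\<^esub> y) (x \<oplus>\<^bsub>M\<^esub> y) = (B x x \<oplus> B y x) \<oplus> (B x y \<oplus> B y y)"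
    using xy by (simp only: form_add_left form_add_right M.a_closed)
  then have "B y x \<oplus> B x y = \<zero>" using xy by simp
  then show ?thesis using xy by (simp add: R.minus_equality)
qed

lemmas form_simps = form_add_left form_add_right form_smult_left form_smult_right

text \<open>
  In terms of the symmetric square of the module, which is the symplectic Lie algebra when 2 is
  invertible, this is the exponential of the product \<open>u w\<close>: for orthogonal \<open>u\<close> and \<open>w\<close> the
  endomorphism \<open>v \<mapsto> \<langle>u, v\<rangle> w + \<langle>w, v\<rangle> u\<close> has square zero.
\<close>
definition transvec :: "'c \<Rightarrow> 'c \<Rightarrow> 'c \<Rightarrow> 'c"
  where "transvec u w = (\<lambda>v\<in>carrier M. v \<oplus>\<^bsub>M\<^esub> (B u v \<odot>\<^bsub>M\<^esub> w \<oplus>\<^bsub>M\<^esub> B w v \<odot>\<^bsub>M\<^esub> u))"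

lemma transvec_apply:
  "v \<in> carrier M \<Longrightarrow> transvec u w v = v \<oplus>\<^bsub>M\<^esub> (B u v \<odot>\<^bsub>M\<^esub> w \<oplus>\<^bsub>M\<^esub> B w v \<odot>\<^bsub>M\<^esub> u)"
  by (simp add: transvec_def)

lemma transvec_closed [simp]:
  "u \<in> carrier M \<Longrightarrow> w \<in> carrier M \<Longrightarrow> v \<in> carrier M \<Longrightarrow> transvec u w v \<in> carrier M"
  by (simp add: transvec_apply)

lemma transvec_commute:
  "u \<in> carrier M \<Longrightarrow> w \<in> carrier M \<Longrightarrow> transvec u w = transvec w u"
  unfolding transvec_def by (rule restrict_ext) (simp add: M.a_comm)

lemma transvec_smult:
  "u \<in> carrier M \<Longrightarrow> w \<in> carrier M \<Longrightarrow> c \<in> carrier R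
    \<Longrightarrow> transvec (c \<odot>\<^bsub>M\<^esub> u) w = transvec u (c \<odot>\<^bsub>M\<^esub> w)"
  unfolding transvec_def by (rule restrict_ext)
    (simp add: form_simps smult_assoc1[symmetric] R.m_comm)

lemma transvec_zero: "u \<in> carrier M \<Longrightarrow> transvec u \<zero>\<^bsub>M\<^esub> = (\<lambda>v\<in>carrier M. v)"
proof -
  assume u: "u \<in> carrier M"
  have "B \<zero>\<^bsub>M\<^esub> v = \<zero>" if "v \<in> carrier M" for v
    using form_smult_left[of \<zero> u v] that u by simp
  then show ?thesis using u unfolding transvec_def by (intro restrict_ext) simp
qed

text \<open>
  The failure of additivity in \<open>w\<close> comes from the vector \<open>\<langle>u, v\<rangle> w'\<close> that the first factor adds to
  \<open>v\<close>: pairing it with \<open>w\<close> contributes \<open>\<langle>u, v\<rangle> \<langle>w, w'\<rangle> u\<close>. A multiple \<open>k u\<close> in the second argument of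
  \<open>transvec u\<close> acts as \<open>v \<mapsto> 2 k \<langle>u, v\<rangle> u\<close>, hence the factor \<open>h\<close>.
\<close>
lemma transvec_transvec:
  assumes [simp]: "u \<in> carrier M" "w \<in> carrier M" "w' \<in> carrier M" "v \<in> carrier M"
    and o: "B u w = \<zero>" "B u w' = \<zero>"
  shows "transvec u w (transvec u w' v) = transvec u (w \<oplus>\<^bsub>M\<^esub> w' \<oplus>\<^bsub>M\<^esub> (h \<otimes> B w w') \<odot>\<^bsub>M\<^esub> u) v"
proof -
  have wu: "B w u = \<zero>" "B w' u = \<zero>" using o form_skew[of u] by auto
  have hh: "h \<otimes> x \<oplus> h \<otimes> x = x" if "x \<in> carrier R" for x
    using half that by (metis R.l_distr R.l_one half_closed)
  define p where "p = B u v \<otimes> B w w'"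
  have p[simp]: "p \<in> carrier R" by (simp add: p_def)
  have L: "transvec u w (transvec u w' v) = 
     v \<oplus>\<^bsub>M\<^esub> B u v \<odot>\<^bsub>M\<^esub> w \<oplus>\<^bsub>M\<^esub> B u v \<odot>\<^bsub>M\<^esub> w' \<oplus>\<^bsub>M\<^esub> B w v \<odot>\<^bsub>M\<^esub> u \<oplus>\<^bsub>M\<^esub> B w' v \<odot>\<^bsub>M\<^esub> u \<oplus>\<^bsub>M\<^esub> p \<odot>\<^bsub>M\<^esub> u"
    by (simp add: transvec_apply form_simps o wu smult_l_distr M.a_ac p_def)
  have R: "transvec u (w \<oplus>\<^bsub>M\<^esub> w' \<oplus>\<^bsub>M\<^esub> (h \<otimes> B w w') \<odot>\<^bsub>M\<^esub> u) v = 
     v \<oplus>\<^bsub>M\<^esub> B u v \<odot>\<^bsub>M\<^esub> w \<oplus>\<^bsub>M\<^esub> B u v \<odot>\<^bsub>M\<^esub> w' \<oplus>\<^bsub>M\<^esub> B w v \<odot>\<^bsub>M\<^esub> u \<oplus>\<^bsub>M\<^esub> B w' v \<odot>\<^bsub>M\<^esub> u \<oplus>\<^bsub>M\<^esub> (h \<otimes> p \<oplus> h \<otimes> p) \<odot>\<^bsub>M\<^esub> u"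
    by (simp add: transvec_apply form_simps o wu smult_l_distr smult_r_distr M.a_ac p_def 
       smult_assoc1[symmetric] R.m_ac)
  show ?thesis unfolding L R by (simp add: hh)
qed

lemma transvec_isometry:
  assumes [simp]: "u \<in> carrier M" "w \<in> carrier M" "x \<in> carrier M" "y \<in> carrier M"
    and o: "B u w = \<zero>"
  shows "B (transvec u w x) (transvec u w y) = B x y"
proof -
  have sk: "B w u = \<zero>" "B x u = \<ominus> B u x" "B x w = \<ominus> B w x"
    using o form_skew[of u w] form_skew[of u x] form_skew[of w x] by simp_all
  have "B (transvec u w x) (transvec u w y) =
    B x y \<oplus> (B u y \<otimes> (\<ominus> B w x) \<oplus> B w y \<otimes> (\<ominus> B u x) \<oplus> B u x \<otimes> B w y \<oplus> B w x \<otimes> B u y)"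
    by (simp add: transvec_apply form_simps o sk R.a_ac)
  also have "\<dots> = B x y"
  proof -
    have "\<And>a b c d. \<lbrakk>a \<in> carrier R; b \<in> carrier R; c \<in> carrier R; d \<in> carrier R\<rbrakk> \<Longrightarrow>
      a \<otimes> (\<ominus> b) \<oplus> c \<otimes> (\<ominus> d) \<oplus> d \<otimes> c \<oplus> b \<otimes> a = \<zero>"
      by (simp add: R.r_minus R.m_comm R.a_assoc R.l_neg R.r_neg1)
    then show ?thesis by simp
  qed
  finally show ?thesis .
qed

abbreviation Isom ("\<G>") where "\<G> \<equiv> Sp R M B"

text \<open>
  Isometries are compared pointwise below; the set \<open>Bij\<close> takes care of their values outside of the
  module.
\<close>
lemma Sp_carrier_iff:
  "g \<in> carrier \<G> \<longleftrightarrow> g \<in> Bij (carrier M) \<and>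
    (\<forall>x\<in>carrier M. \<forall>y\<in>carrier M. g (x \<oplus>\<^bsub>M\<^esub> y) = g x \<oplus>\<^bsub>M\<^esub> g y) \<and>
    (\<forall>a\<in>carrier R. \<forall>x\<in>carrier M. g (a \<odot>\<^bsub>M\<^esub> x) = a \<odot>\<^bsub>M\<^esub> g x) \<and>
    (\<forall>x\<in>carrier M. \<forall>y\<in>carrier M. B (g x) (g y) = B x y)"
  unfolding Sp_def module_iso_def module_hom_def Bij_def
  by (auto simp: PiE_def dest: bij_betw_imp_funcset)

lemma
  assumes "g \<in> carrier \<G>"
  shows Sp_closed: "x \<in> carrier M \<Longrightarrow> g x \<in> carrier M"
    and Sp_add: "x \<in> carrier M \<Longrightarrow> y \<in> carrier M \<Longrightarrow> g (x \<oplus>\<^bsub>M\<^esub> y) = g x \<oplus>\<^bsub>M\<^esub> g y"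
    and Sp_smult: "a \<in> carrier R \<Longrightarrow> x \<in> carrier M \<Longrightarrow> g (a \<odot>\<^bsub>M\<^esub> x) = a \<odot>\<^bsub>M\<^esub> g x"
    and Sp_form: "x \<in> carrier M \<Longrightarrow> y \<in> carrier M \<Longrightarrow> B (g x) (g y) = B x y"
    and Sp_Bij: "g \<in> Bij (carrier M)"
  using assms by (auto simp: Sp_carrier_iff Bij_def dest: bij_betwE)

lemma subgroup_Sp: "subgroup (carrier \<G>) (BijGroup (carrier M))"
proof -
  interpret S: group "BijGroup (carrier M)" by (rule group_BijGroup)
  have inv: "g ((inv\<^bsub>BijGroup (carrier M)\<^esub> g) x) = x \<and> (inv\<^bsub>BijGroup (carrier M)\<^esub> g) x \<in> carrier M"
    if "g \<in> carrier \<G>" "x \<in> carrier M" for g x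
    using Sp_Bij[OF that(1)] that(2)
    by (simp add: inv_BijGroup) (auto simp: Bij_def bij_betw_def f_inv_into_f inv_into_into)
  have carrier_BijGroup: "carrier (BijGroup (carrier M)) = Bij (carrier M)"
    by (simp add: BijGroup_def)
  show ?thesis
  proof (rule S.subgroupI)
    show "carrier \<G> \<subseteq> carrier (BijGroup (carrier M))"
      using Sp_Bij by (auto simp: BijGroup_def)
    have "(\<lambda>x\<in>carrier M. x) \<in> carrier \<G>" by (simp add: Sp_carrier_iff id_Bij)
    then show "carrier \<G> \<noteq> {}" by blast
  next
    fix g assume g: "g \<in> carrier \<G>"
    let ?i = "inv\<^bsub>BijGroup (carrier M)\<^esub> g"
    have inj: "x = y" if "g x = g y" "x \<in> carrier M" "y \<in> carrier M" for x y
      using Sp_Bij[OF g] that by (auto simp: Bij_def bij_betw_def inj_on_def)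
    have "?i \<in> Bij (carrier M)"
      using S.inv_closed[of g] Sp_Bij[OF g] unfolding carrier_BijGroup .
    moreover have "?i (x \<oplus>\<^bsub>M\<^esub> y) = ?i x \<oplus>\<^bsub>M\<^esub> ?i y" if "x \<in> carrier M" "y \<in> carrier M" for x y
      by (rule inj) (use that in \<open>simp_all add: inv[OF g] Sp_add[OF g]\<close>)
    moreover have "?i (a \<odot>\<^bsub>M\<^esub> x) = a \<odot>\<^bsub>M\<^esub> ?i x" if "a \<in> carrier R" "x \<in> carrier M" for a x
      by (rule inj) (use that in \<open>simp_all add: inv[OF g] Sp_smult[OF g]\<close>)
    moreover have "B (?i x) (?i y) = B x y" if "x \<in> carrier M" "y \<in> carrier M" for x y
      using Sp_form[OF g, of "?i x" "?i y"] that by (simp add: inv[OF g])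
    ultimately show "?i \<in> carrier \<G>" by (simp add: Sp_carrier_iff)
  next
    fix g f assume gf: "g \<in> carrier \<G>" "f \<in> carrier \<G>"
    then show "g \<otimes>\<^bsub>BijGroup (carrier M)\<^esub> f \<in> carrier \<G>"
      unfolding Sp_carrier_iff[of "g \<otimes>\<^bsub>_\<^esub> f"]
      by (simp add: BijGroup_def Sp_Bij compose_Bij compose_eq Sp_closed Sp_add Sp_smult Sp_form)
  qed
qed

lemma Sp_group: "group \<G>"
proof -
  have "\<G> = (BijGroup (carrier M))\<lparr>carrier := carrier \<G>\<rparr>" by (simp add: Sp_def)
  then show ?thesis
    using subgroup.subgroup_is_group[OF subgroup_Sp group_BijGroup] by simp
qed

sublocale Sp: group \<G> by (rule Sp_group)

lemma Sp_mult_apply [simp]: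
  "g \<in> carrier \<G> \<Longrightarrow> f \<in> carrier \<G> \<Longrightarrow> x \<in> carrier M \<Longrightarrow> (g \<otimes>\<^bsub>\<G>\<^esub> f) x = g (f x)"
  using Sp_Bij[of g] Sp_Bij[of f] by (simp add: Sp_def BijGroup_def compose_eq)

lemma Sp_one_eq: "\<one>\<^bsub>\<G>\<^esub> = (\<lambda>x\<in>carrier M. x)"
  by (simp add: Sp_def BijGroup_def)

lemma Sp_apply_inv:
  "g \<in> carrier \<G> \<Longrightarrow> x \<in> carrier M \<Longrightarrow> g ((inv\<^bsub>\<G>\<^esub> g) x) = x"
  using Sp_mult_apply[of g "inv\<^bsub>\<G>\<^esub> g" x] by (simp add: Sp_one_eq del: Sp_mult_apply)

lemma Sp_eqI:
  "g \<in> carrier \<G> \<Longrightarrow> f \<in> carrier \<G> \<Longrightarrow> (\<And>x. x \<in> carrier M \<Longrightarrow> g x = f x) \<Longrightarrow> g = f"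
  using Sp_Bij[of g] Sp_Bij[of f] by (auto simp: Bij_def intro: extensionalityI)

lemma transvec_in_Sp [simp]:
  assumes u[simp]: "u \<in> carrier M" and w[simp]: "w \<in> carrier M" and o: "B u w = \<zero>"
  shows "transvec u w \<in> carrier \<G>"
proof -
  let ?w = "(\<ominus> \<one>) \<odot>\<^bsub>M\<^esub> w"
  have o': "B u ?w = \<zero>" "B w ?w = \<zero>" "B ?w w = \<zero>" by (simp_all add: form_simps o)
  have s: "w \<oplus>\<^bsub>M\<^esub> ?w = \<zero>\<^bsub>M\<^esub>" "?w \<oplus>\<^bsub>M\<^esub> w = \<zero>\<^bsub>M\<^esub>"
    by (simp_all add: smult_l_minus M.r_neg M.l_neg)
  have i1: "transvec u w (transvec u ?w v) = v" if "v \<in> carrier M" for v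
    using that by (simp add: transvec_transvec o o' s transvec_zero)
  have i2: "transvec u ?w (transvec u w v) = v" if "v \<in> carrier M" for v
    using that by (simp add: transvec_transvec o o' s transvec_zero)
  have "bij_betw (transvec u w) (carrier M) (carrier M)"
    by (rule bij_betw_byWitness[where f' = "transvec u ?w"]) (auto simp: i1 i2)
  then have "transvec u w \<in> Bij (carrier M)" by (simp add: Bij_def transvec_def)
  moreover have "transvec u w (x \<oplus>\<^bsub>M\<^esub> y) = transvec u w x \<oplus>\<^bsub>M\<^esub> transvec u w y"
    if "x \<in> carrier M" "y \<in> carrier M" for x y
    using that by (simp add: transvec_apply form_simps smult_l_distr M.a_ac)
  moreover have "transvec u w (a \<odot>\<^bsub>M\<^esub> x) = a \<odot>\<^bsub>M\<^esub> transvec u w x"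
    if "a \<in> carrier R" "x \<in> carrier M" for a x
    using that by (simp add: transvec_apply form_simps smult_r_distr smult_assoc1)
  ultimately show ?thesis by (simp add: Sp_carrier_iff transvec_isometry o)
qed

lemma transvec_mult:
  assumes "u \<in> carrier M" "w \<in> carrier M" "w' \<in> carrier M" "B u w = \<zero>" "B u w' = \<zero>"
  shows "transvec u w \<otimes>\<^bsub>\<G>\<^esub> transvec u w' = transvec u (w \<oplus>\<^bsub>M\<^esub> w' \<oplus>\<^bsub>M\<^esub> (h \<otimes> B w w') \<odot>\<^bsub>M\<^esub> u)"
  using assms by (intro Sp_eqI) (simp_all add: transvec_transvec form_simps)

lemma transvec_mult_orth:
  assumes "u \<in> carrier M" "w \<in> carrier M" "w' \<in> carrier M" "B u w = \<zero>" "B u w' = \<zero>" "B w w' = \<zero>"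
  shows "transvec u w \<otimes>\<^bsub>\<G>\<^esub> transvec u w' = transvec u (w \<oplus>\<^bsub>M\<^esub> w')"
  using assms by (simp add: transvec_mult)

text \<open>
  Everything in the definition of \<open>transvec\<close> is expressed by the module operations and the form, so
  isometries carry it along. This reduces normality to transvections along the vectors \<open>g u\<close>.
\<close>
lemma transvec_conj:
  assumes "g \<in> carrier \<G>" "u \<in> carrier M" "w \<in> carrier M" "B u w = \<zero>"
  shows "g \<otimes>\<^bsub>\<G>\<^esub> transvec u w \<otimes>\<^bsub>\<G>\<^esub> inv\<^bsub>\<G>\<^esub> g = transvec (g u) (g w)"
proof -
  have "g \<otimes>\<^bsub>\<G>\<^esub> transvec u w = transvec (g u) (g w) \<otimes>\<^bsub>\<G>\<^esub> g"
    using assms by (intro Sp_eqI) (simp_all add: Sp_form transvec_apply Sp_closed Sp_add Sp_smult)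
  then show ?thesis using assms by (simp add: Sp.m_assoc Sp_form Sp_closed)
qed

section \<open>Lines of transvections in a subgroup\<close>

definition perp :: "'c \<Rightarrow> 'c set"
  where "perp u = {w \<in> carrier M. B u w = \<zero>}"

text \<open>
  The scalar \<open>r\<close> makes this set closed under scalar multiplication, and it provides the half of a
  vector that the symmetric product formula requires.
\<close>
definition transvec_lines :: "('c \<Rightarrow> 'c) set \<Rightarrow> 'c \<Rightarrow> 'c set"
  where "transvec_lines N u = {w \<in> perp u. \<forall>r\<in>carrier R. transvec u (r \<odot>\<^bsub>M\<^esub> w) \<in> N}"

lemma perp_carrier: "w \<in> perp u \<Longrightarrow> w \<in> carrier M"
  by (simp add: perp_def)

lemma perp_sym: "u \<in> carrier M \<Longrightarrow> w \<in> carrier M \<Longrightarrow> B u w = \<zero> \<Longrightarrow> B w u = \<zero>"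
  using form_skew[of u w] by simp

lemma submoduleI':
  assumes "H \<subseteq> carrier M" "\<zero>\<^bsub>M\<^esub> \<in> H" "\<And>x y. x \<in> H \<Longrightarrow> y \<in> H \<Longrightarrow> x \<oplus>\<^bsub>M\<^esub> y \<in> H"
    "\<And>a x. a \<in> carrier R \<Longrightarrow> x \<in> H \<Longrightarrow> a \<odot>\<^bsub>M\<^esub> x \<in> H"
  shows "submodule H R M"
proof (rule submoduleI)
  fix a assume a: "a \<in> H"
  then have "\<ominus>\<^bsub>M\<^esub> a = (\<ominus> \<one>) \<odot>\<^bsub>M\<^esub> a" using assms(1) by (auto simp: smult_l_minus)
  then show "\<ominus>\<^bsub>M\<^esub> a \<in> H" using a assms(4)[of "\<ominus> \<one>" a] by simp
qed (use assms in auto)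

lemma submodule_zero: "submodule H R M \<Longrightarrow> \<zero>\<^bsub>M\<^esub> \<in> H"
  using subgroup.one_closed[OF submodule.axioms(1), of H R M] by simp

lemma form_zero [simp]: "x \<in> carrier M \<Longrightarrow> B x \<zero>\<^bsub>M\<^esub> = \<zero>" "x \<in> carrier M \<Longrightarrow> B \<zero>\<^bsub>M\<^esub> x = \<zero>"
  using form_smult_right[of \<zero> x x] form_smult_left[of \<zero> x x] by simp_all

lemma half_double: "x \<in> carrier M \<Longrightarrow> h \<odot>\<^bsub>M\<^esub> x \<oplus>\<^bsub>M\<^esub> h \<odot>\<^bsub>M\<^esub> x = x"
  using smult_l_distr[of h h x] by (simp add: half)

text \<open>
  Splitting \<open>x\<close> symmetrically around \<open>y\<close> makes the two correction terms of the product formula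
  cancel, since the form is alternating.
\<close>
lemma transvec_add:
  assumes [simp]: "u \<in> carrier M" "x \<in> carrier M" "y \<in> carrier M" and o: "B u x = \<zero>" "B u y = \<zero>"
  shows "transvec u (x \<oplus>\<^bsub>M\<^esub> y) =
    transvec u (h \<odot>\<^bsub>M\<^esub> x) \<otimes>\<^bsub>\<G>\<^esub> transvec u y \<otimes>\<^bsub>\<G>\<^esub> transvec u (h \<odot>\<^bsub>M\<^esub> x)"
proof -
  let ?k = "h \<otimes> (h \<otimes> B x y)"
  have sk: "B y x = \<ominus> B x y" by (rule form_skew) simp_all
  have "transvec u (h \<odot>\<^bsub>M\<^esub> x) \<otimes>\<^bsub>\<G>\<^esub> transvec u y = transvec u (h \<odot>\<^bsub>M\<^esub> x \<oplus>\<^bsub>M\<^esub> y \<oplus>\<^bsub>M\<^esub> ?k \<odot>\<^bsub>M\<^esub> u)"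
    by (simp add: transvec_mult form_simps o)
  then have "transvec u (h \<odot>\<^bsub>M\<^esub> x) \<otimes>\<^bsub>\<G>\<^esub> transvec u y \<otimes>\<^bsub>\<G>\<^esub> transvec u (h \<odot>\<^bsub>M\<^esub> x) =
    transvec u (h \<odot>\<^bsub>M\<^esub> x \<oplus>\<^bsub>M\<^esub> y \<oplus>\<^bsub>M\<^esub> ?k \<odot>\<^bsub>M\<^esub> u \<oplus>\<^bsub>M\<^esub> h \<odot>\<^bsub>M\<^esub> x \<oplus>\<^bsub>M\<^esub> (\<ominus> ?k) \<odot>\<^bsub>M\<^esub> u)"
    by (simp add: transvec_mult form_simps o sk R.r_minus)
  also have "h \<odot>\<^bsub>M\<^esub> x \<oplus>\<^bsub>M\<^esub> y \<oplus>\<^bsub>M\<^esub> ?k \<odot>\<^bsub>M\<^esub> u \<oplus>\<^bsub>M\<^esub> h \<odot>\<^bsub>M\<^esub> x \<oplus>\<^bsub>M\<^esub> (\<ominus> ?k) \<odot>\<^bsub>M\<^esub> u =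
    (h \<odot>\<^bsub>M\<^esub> x \<oplus>\<^bsub>M\<^esub> h \<odot>\<^bsub>M\<^esub> x) \<oplus>\<^bsub>M\<^esub> y \<oplus>\<^bsub>M\<^esub> (?k \<odot>\<^bsub>M\<^esub> u \<oplus>\<^bsub>M\<^esub> (\<ominus> ?k) \<odot>\<^bsub>M\<^esub> u)"
    by (simp add: M.a_ac)
  also have "\<dots> = x \<oplus>\<^bsub>M\<^esub> y"
    by (simp add: half_double smult_l_minus M.r_neg)
  finally show ?thesis by simp
qed

lemma submodule_transvec_lines:
  assumes N: "subgroup N \<G>" and u[simp]: "u \<in> carrier M"
  shows "submodule (transvec_lines N u) R M"
proof (rule submoduleI')
  show "transvec_lines N u \<subseteq> carrier M" by (auto simp: transvec_lines_def perp_def)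
  have "transvec u \<zero>\<^bsub>M\<^esub> \<in> N"
    using subgroup.one_closed[OF N] by (simp add: transvec_zero Sp_one_eq)
  then show "\<zero>\<^bsub>M\<^esub> \<in> transvec_lines N u" by (simp add: transvec_lines_def perp_def)
next
  fix a x assume "a \<in> carrier R" "x \<in> transvec_lines N u"
  then show "a \<odot>\<^bsub>M\<^esub> x \<in> transvec_lines N u"
    by (simp add: transvec_lines_def perp_def form_simps smult_assoc1[symmetric])
next
  fix x y assume x: "x \<in> transvec_lines N u" and y: "y \<in> transvec_lines N u"
  then have [simp]: "x \<in> carrier M" "y \<in> carrier M" and o: "B u x = \<zero>" "B u y = \<zero>"
    by (simp_all add: transvec_lines_def perp_def)
  have "transvec u (r \<odot>\<^bsub>M\<^esub> (x \<oplus>\<^bsub>M\<^esub> y)) \<in> N" if [simp]: "r \<in> carrier R" for r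
  proof -
    have "transvec u ((h \<otimes> r) \<odot>\<^bsub>M\<^esub> x) \<in> N" "transvec u (r \<odot>\<^bsub>M\<^esub> y) \<in> N"
      using x y unfolding transvec_lines_def by auto
    then have "transvec u (h \<odot>\<^bsub>M\<^esub> (r \<odot>\<^bsub>M\<^esub> x)) \<otimes>\<^bsub>\<G>\<^esub> transvec u (r \<odot>\<^bsub>M\<^esub> y)
        \<otimes>\<^bsub>\<G>\<^esub> transvec u (h \<odot>\<^bsub>M\<^esub> (r \<odot>\<^bsub>M\<^esub> x)) \<in> N"
      by (simp add: smult_assoc1 subgroup.m_closed[OF N])
    then show ?thesis by (simp add: smult_r_distr transvec_add form_simps o)
  qed
  then show "x \<oplus>\<^bsub>M\<^esub> y \<in> transvec_lines N u"
    by (simp add: transvec_lines_def perp_def form_simps o)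
qed

section \<open>The map from the exterior square onto the orthogonal complement\<close>

text \<open>
  The contraction of the bivector \<open>x \<and> y\<close> with the linear form \<open>\<langle>u, -\<rangle>\<close>, up to sign. It is written
  without subtraction, using that \<open>\<langle>y, u\<rangle> = - \<langle>u, y\<rangle>\<close>.
\<close>
definition wedge :: "'c \<Rightarrow> 'c \<Rightarrow> 'c \<Rightarrow> 'c"
  where "wedge u x y = B y u \<odot>\<^bsub>M\<^esub> x \<oplus>\<^bsub>M\<^esub> B u x \<odot>\<^bsub>M\<^esub> y"

lemma wedge_closed [simp]:
  "u \<in> carrier M \<Longrightarrow> x \<in> carrier M \<Longrightarrow> y \<in> carrier M \<Longrightarrow> wedge u x y \<in> carrier M"
  by (simp add: wedge_def)

lemma wedge_perp:
  assumes [simp]: "u \<in> carrier M" "x \<in> carrier M" "y \<in> carrier M"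
  shows "B u (wedge u x y) = \<zero>"
proof -
  have "B y u = \<ominus> B u y" by (rule form_skew) simp_all
  then show ?thesis by (simp add: wedge_def form_simps R.m_comm R.l_minus R.r_minus R.l_neg)
qed

lemma wedge_self: "u \<in> carrier M \<Longrightarrow> x \<in> carrier M \<Longrightarrow> wedge u x x = \<zero>\<^bsub>M\<^esub>"
  using form_skew[of u x] by (simp add: wedge_def smult_l_minus M.l_neg)

lemma wedge_add_left:
  "u \<in> carrier M \<Longrightarrow> x \<in> carrier M \<Longrightarrow> x' \<in> carrier M \<Longrightarrow> y \<in> carrier M \<Longrightarrow>
    wedge u (x \<oplus>\<^bsub>M\<^esub> x') y = wedge u x y \<oplus>\<^bsub>M\<^esub> wedge u x' y"
  by (simp add: wedge_def form_simps smult_l_distr smult_r_distr M.a_ac)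

lemma wedge_add_right:
  "u \<in> carrier M \<Longrightarrow> x \<in> carrier M \<Longrightarrow> y \<in> carrier M \<Longrightarrow> y' \<in> carrier M \<Longrightarrow>
    wedge u x (y \<oplus>\<^bsub>M\<^esub> y') = wedge u x y \<oplus>\<^bsub>M\<^esub> wedge u x y'"
  by (simp add: wedge_def form_simps smult_l_distr smult_r_distr M.a_ac)

lemma wedge_smult_left:
  "u \<in> carrier M \<Longrightarrow> x \<in> carrier M \<Longrightarrow> y \<in> carrier M \<Longrightarrow> a \<in> carrier R \<Longrightarrow>
    wedge u (a \<odot>\<^bsub>M\<^esub> x) y = a \<odot>\<^bsub>M\<^esub> wedge u x y"
  by (simp add: wedge_def form_simps smult_r_distr smult_assoc1[symmetric] R.m_ac)

lemma wedge_smult_right: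
  "u \<in> carrier M \<Longrightarrow> x \<in> carrier M \<Longrightarrow> y \<in> carrier M \<Longrightarrow> a \<in> carrier R \<Longrightarrow>
    wedge u x (a \<odot>\<^bsub>M\<^esub> y) = a \<odot>\<^bsub>M\<^esub> wedge u x y"
  by (simp add: wedge_def form_simps smult_r_distr smult_assoc1[symmetric] R.m_ac)

lemma wedge_skew:
  assumes [simp]: "u \<in> carrier M" "x \<in> carrier M" "y \<in> carrier M"
  shows "wedge u y x = \<ominus>\<^bsub>M\<^esub> wedge u x y"
proof -
  have "B y u = \<ominus> B u y" "B x u = \<ominus> B u x" by (rule form_skew; simp)+
  then have "wedge u y x \<oplus>\<^bsub>M\<^esub> wedge u x y = \<zero>\<^bsub>M\<^esub>"
    by (simp add: wedge_def smult_l_minus M.a_ac M.l_neg M.r_neg M.r_neg1 M.r_neg2)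
  then show ?thesis using M.minus_equality by simp
qed

text \<open>
  With this, a statement about all \<open>wedge u x y\<close> can be checked for \<open>x\<close> and \<open>y\<close> in a generating set.
\<close>
lemma submodule_wedge_left:
  assumes H: "submodule H R M" and [simp]: "u \<in> carrier M" "y \<in> carrier M" "c \<in> carrier R"
  shows "submodule {x \<in> carrier M. c \<odot>\<^bsub>M\<^esub> wedge u x y \<in> H} R M"
proof (rule submoduleI')
  have "wedge u \<zero>\<^bsub>M\<^esub> y = \<zero>\<^bsub>M\<^esub>" by (simp add: wedge_def)
  then show "\<zero>\<^bsub>M\<^esub> \<in> {x \<in> carrier M. c \<odot>\<^bsub>M\<^esub> wedge u x y \<in> H}"
    by (simp add: submodule_zero[OF H])
next
  fix a x assume a[simp]: "a \<in> carrier R" and x: "x \<in> {x \<in> carrier M. c \<odot>\<^bsub>M\<^esub> wedge u x y \<in> H}"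
  then have "a \<odot>\<^bsub>M\<^esub> (c \<odot>\<^bsub>M\<^esub> wedge u x y) \<in> H" using submoduleE(4)[OF H] by simp
  then show "a \<odot>\<^bsub>M\<^esub> x \<in> {x \<in> carrier M. c \<odot>\<^bsub>M\<^esub> wedge u x y \<in> H}"
    using x by (simp add: wedge_smult_left smult_assoc1[symmetric] R.m_comm)
qed (auto simp: wedge_add_left smult_r_distr submoduleE(5)[OF H])

end

section \<open>Hyperbolic pairs and the elementary group\<close>

locale hyperbolic_pair = alternating_space +
  fixes e f :: 'c
  assumes e_closed [simp]: "e \<in> carrier M" and f_closed [simp]: "f \<in> carrier M"
    and e_f [simp]: "B e f = \<one>"
begin

lemma f_e [simp]: "B f e = \<ominus> \<one>"
  using form_skew[of e f] by simp

text \<open>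
  The orthogonal complement of the hyperbolic plane; in \<open>R\<^sup>2 \<oplus> P\<close> it is \<open>P\<close>.
\<close>
definition core :: "'c set"
  where "core = {x \<in> carrier M. B e x = \<zero> \<and> B f x = \<zero>}"

lemma core_closed: "x \<in> core \<Longrightarrow> x \<in> carrier M"
  and core_orth: "x \<in> core \<Longrightarrow> B e x = \<zero>" "x \<in> core \<Longrightarrow> B f x = \<zero>"
    "x \<in> core \<Longrightarrow> B x e = \<zero>" "x \<in> core \<Longrightarrow> B x f = \<zero>"
  using form_skew[of e x] form_skew[of f x] by (auto simp: core_def)

lemma core_add: "x \<in> core \<Longrightarrow> y \<in> core \<Longrightarrow> x \<oplus>\<^bsub>M\<^esub> y \<in> core"
  and core_smult: "a \<in> carrier R \<Longrightarrow> x \<in> core \<Longrightarrow> a \<odot>\<^bsub>M\<^esub> x \<in> core"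
  by (auto simp: core_def form_simps)

text \<open>
  Subtracting from \<open>v\<close> its projection \<open>\<langle>v, f\<rangle> e + \<langle>e, v\<rangle> f\<close> to the hyperbolic plane leaves a vector
  of the complement.
\<close>
lemma hyperbolic_decomposition:
  assumes [simp]: "v \<in> carrier M"
  obtains a b p where "a \<in> carrier R" "b \<in> carrier R" "p \<in> core" 
    "v = a \<odot>\<^bsub>M\<^esub> e \<oplus>\<^bsub>M\<^esub> (b \<odot>\<^bsub>M\<^esub> f \<oplus>\<^bsub>M\<^esub> p)"
proof -
  let ?a = "B v f" and ?b = "B e v"
  let ?w = "?a \<odot>\<^bsub>M\<^esub> e \<oplus>\<^bsub>M\<^esub> ?b \<odot>\<^bsub>M\<^esub> f"
  let ?p = "(\<ominus> \<one>) \<odot>\<^bsub>M\<^esub> ?w \<oplus>\<^bsub>M\<^esub> v"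
  have fv: "B f v = \<ominus> B v f" by (rule form_skew) simp_all
  have "?p \<in> core"
    by (simp add: core_def form_simps fv R.l_minus R.r_minus R.l_neg R.r_neg)
  moreover have "v = ?w \<oplus>\<^bsub>M\<^esub> ?p"
    by (simp add: smult_l_minus M.r_neg1)
      (simp add: M.a_assoc[symmetric] M.r_neg)
  then have "v = ?a \<odot>\<^bsub>M\<^esub> e \<oplus>\<^bsub>M\<^esub> (?b \<odot>\<^bsub>M\<^esub> f \<oplus>\<^bsub>M\<^esub> ?p)"
    by (simp only: M.a_assoc smult_closed form_closed e_closed f_closed assms M.a_closed R.a_inv_closed R.one_closed)
  ultimately show ?thesis by (intro that[of ?a ?b ?p]) simp_all
qed

lemma submodule_eq_carrier:
  assumes H: "submodule H R M" and "e \<in> H" "f \<in> H" "core \<subseteq> H"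
  shows "H = carrier M"
proof
  show "H \<subseteq> carrier M" by (rule submoduleE(1)[OF H])
  show "carrier M \<subseteq> H"
  proof
    fix v assume "v \<in> carrier M"
    then show "v \<in> H"
      by (rule hyperbolic_decomposition)
        (use assms submoduleE(4,5)[OF H] in \<open>auto intro!: submoduleE(4,5)[OF H]\<close>)
  qed
qed

text \<open>
  For \<open>R\<^sup>2 \<oplus> P\<close> and its standard pair this is \<open>ETrans\<^sub>S\<^sub>p(Q)\<close>, see \<open>ETrans_eq\<close>.
\<close>
definition elementary :: "('c \<Rightarrow> 'c) set"
  where "elementary = generate \<G> (transvec e ` perp e \<union> transvec f ` perp f)"

lemma elementary_gens: "transvec e ` perp e \<union> transvec f ` perp f \<subseteq> carrier \<G>"
  by (auto simp: perp_def)

lemma elementary_subgroup: "subgroup elementary \<G>"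
  unfolding elementary_def by (rule Sp.generate_is_subgroup[OF elementary_gens])

lemma elementary_Sp: "\<gamma> \<in> elementary \<Longrightarrow> \<gamma> \<in> carrier \<G>"
  using subgroup.subset[OF elementary_subgroup] by auto

lemma transvec_elementary:
  "d \<in> {e, f} \<Longrightarrow> w \<in> carrier M \<Longrightarrow> B d w = \<zero> \<Longrightarrow> transvec d w \<in> elementary"
  unfolding elementary_def by (auto intro!: generate.incl simp: perp_def)

text \<open>
  Conjugation by \<open>transvec e q\<close> fixes \<open>p\<close> and moves \<open>f\<close> to \<open>q + f\<close>, so it turns \<open>transvec f p\<close> into
  \<open>transvec (q + f) p\<close>. This is the product of \<open>transvec q p\<close> and \<open>transvec f p\<close>, because \<open>q\<close> and \<open>f\<close>
  are orthogonal.
\<close>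
lemma transvec_core_eq_commutator:
  assumes q: "q \<in> core" and p: "p \<in> core" and o: "B q p = \<zero>"
  shows "transvec q p = transvec e q \<otimes>\<^bsub>\<G>\<^esub> (transvec f p \<otimes>\<^bsub>\<G>\<^esub> inv\<^bsub>\<G>\<^esub> (transvec e q) \<otimes>\<^bsub>\<G>\<^esub> inv\<^bsub>\<G>\<^esub> (transvec f p))"
proof -
  note [simp] = core_closed[OF q] core_closed[OF p] core_orth[OF q] core_orth[OF p]
  have o': "B p q = \<zero>" using o perp_sym by simp
  have eqf: "transvec e q f = q \<oplus>\<^bsub>M\<^esub> f" by (simp add: transvec_apply M.a_comm)
  have eqp: "transvec e q p = p" by (simp add: transvec_apply o)
  have "transvec e q \<otimes>\<^bsub>\<G>\<^esub> transvec f p \<otimes>\<^bsub>\<G>\<^esub> inv\<^bsub>\<G>\<^esub> (transvec e q) = transvec (q \<oplus>\<^bsub>M\<^esub> f) p"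
    by (simp add: transvec_conj eqf eqp)
  also have "\<dots> = transvec p (q \<oplus>\<^bsub>M\<^esub> f)" by (simp add: transvec_commute)
  also have "\<dots> = transvec p q \<otimes>\<^bsub>\<G>\<^esub> transvec p f"
    by (rule transvec_mult_orth[symmetric]) (simp_all add: o')
  also have "\<dots> = transvec q p \<otimes>\<^bsub>\<G>\<^esub> transvec f p"
    by (simp add: transvec_commute)
  finally have "transvec e q \<otimes>\<^bsub>\<G>\<^esub> transvec f p \<otimes>\<^bsub>\<G>\<^esub> inv\<^bsub>\<G>\<^esub> (transvec e q) \<otimes>\<^bsub>\<G>\<^esub> inv\<^bsub>\<G>\<^esub> (transvec f p)
      = transvec q p \<otimes>\<^bsub>\<G>\<^esub> transvec f p \<otimes>\<^bsub>\<G>\<^esub> inv\<^bsub>\<G>\<^esub> (transvec f p)"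
    by simp
  then show ?thesis by (simp add: Sp.m_assoc o)
qed

text \<open>
  It suffices to treat the components of \<open>v\<close>. For \<open>e\<close> and \<open>f\<close> the symmetry of transvections exchanges
  the roles of the two arguments; for the component in the core the commutator formula applies, and
  the commutator lies in \<open>N\<close> because \<open>N\<close> contains \<open>transvec e q\<close> and is normalized by the
  elementary group.
\<close>
lemma core_transvec_lines:
  assumes N: "subgroup N \<G>"
    and conj: "\<And>\<gamma> \<tau>. \<gamma> \<in> elementary \<Longrightarrow> \<tau> \<in> N \<Longrightarrow> \<gamma> \<otimes>\<^bsub>\<G>\<^esub> \<tau> \<otimes>\<^bsub>\<G>\<^esub> inv\<^bsub>\<G>\<^esub> \<gamma> \<in> N"
    and q: "q \<in> core" "q \<in> transvec_lines N e" "q \<in> transvec_lines N f"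
    and v: "v \<in> carrier M" "B q v = \<zero>"
  shows "v \<in> transvec_lines N q"
proof -
  note qs[simp] = core_closed[OF q(1)] core_orth[OF q(1)]
  have S: "submodule (transvec_lines N q) R M" by (rule submodule_transvec_lines[OF N]) simp
  note S = submoduleE(4,5)[OF S]
  have lines: "d \<in> transvec_lines N q" if "q \<in> transvec_lines N d" "d \<in> carrier M" for d
  proof -
    have "transvec q (r \<odot>\<^bsub>M\<^esub> d) \<in> N" if "r \<in> carrier R" for r
    proof -
      have "transvec q (r \<odot>\<^bsub>M\<^esub> d) = transvec d (r \<odot>\<^bsub>M\<^esub> q)"
        using that \<open>d \<in> carrier M\<close> by (simp add: transvec_commute[of q] transvec_smult)
      then show ?thesis using \<open>q \<in> transvec_lines N d\<close> that by (simp add: transvec_lines_def)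
    qed
    moreover have "B q d = \<zero>" using that perp_sym[of d q] by (simp add: transvec_lines_def perp_def)
    ultimately show ?thesis using that by (simp add: transvec_lines_def perp_def)
  qed
  obtain a b p where ab: "a \<in> carrier R" "b \<in> carrier R" and p: "p \<in> core"
    and vp: "v = a \<odot>\<^bsub>M\<^esub> e \<oplus>\<^bsub>M\<^esub> (b \<odot>\<^bsub>M\<^esub> f \<oplus>\<^bsub>M\<^esub> p)"
    using v(1) by (rule hyperbolic_decomposition)
  note [simp] = ab core_closed[OF p] core_orth[OF p]
  have qp: "B q p = \<zero>" using v(2) by (simp add: vp form_simps)
  have "transvec q (r \<odot>\<^bsub>M\<^esub> p) \<in> N" if r: "r \<in> carrier R" for r
  proof -
    let ?p = "r \<odot>\<^bsub>M\<^esub> p"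
    have eq: "transvec e q \<in> N"
      using q(2) by (auto simp: transvec_lines_def dest: bspec[of _ _ "\<one>"])
    have "transvec f ?p \<in> elementary" using r by (intro transvec_elementary) (simp_all add: form_simps)
    then have "transvec f ?p \<otimes>\<^bsub>\<G>\<^esub> inv\<^bsub>\<G>\<^esub> (transvec e q) \<otimes>\<^bsub>\<G>\<^esub> inv\<^bsub>\<G>\<^esub> (transvec f ?p) \<in> N"
      by (rule conj) (rule subgroup.m_inv_closed[OF N eq])
    then show ?thesis
      using transvec_core_eq_commutator[OF q(1) core_smult[OF r p]] subgroup.m_closed[OF N eq] r
      by (simp add: form_simps qp)
  qed
  then have "p \<in> transvec_lines N q" by (simp add: transvec_lines_def perp_def qp)
  moreover have "e \<in> transvec_lines N q" "f \<in> transvec_lines N q" using q(2,3) by (simp_all add: lines)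
  ultimately show ?thesis unfolding vp by (simp add: S)
qed

text \<open>
  The transvection with arguments \<open>u\<close> and \<open>c \<gamma> q\<close> is conjugate under \<open>\<gamma>\<close> to the one with arguments
  \<open>\<gamma>\<inverse> u\<close> and \<open>c q\<close>, and \<open>c q\<close> lies in the core.
\<close>
lemma transvec_lines_conj:
  assumes N: "subgroup N \<G>"
    and conj: "\<And>\<gamma> \<tau>. \<gamma> \<in> elementary \<Longrightarrow> \<tau> \<in> N \<Longrightarrow> \<gamma> \<otimes>\<^bsub>\<G>\<^esub> \<tau> \<otimes>\<^bsub>\<G>\<^esub> inv\<^bsub>\<G>\<^esub> \<gamma> \<in> N"
    and q: "q \<in> core" and c: "c \<in> carrier R"
    and cq: "c \<odot>\<^bsub>M\<^esub> q \<in> transvec_lines N e" "c \<odot>\<^bsub>M\<^esub> q \<in> transvec_lines N f"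
    and u: "u \<in> carrier M" and \<gamma>: "\<gamma> \<in> elementary" and o: "B u (\<gamma> q) = \<zero>"
  shows "c \<odot>\<^bsub>M\<^esub> \<gamma> q \<in> transvec_lines N u"
proof -
  note [simp] = core_closed[OF q] c u
  have \<gamma>G: "\<gamma> \<in> carrier \<G>" by (rule elementary_Sp[OF \<gamma>])
  let ?v = "(inv\<^bsub>\<G>\<^esub> \<gamma>) u"
  have v[simp]: "?v \<in> carrier M" by (rule Sp_closed[OF Sp.inv_closed[OF \<gamma>G] u])
  have \<gamma>v: "\<gamma> ?v = u" by (simp add: Sp_apply_inv \<gamma>G)
  have vq: "B ?v q = \<zero>" using Sp_form[OF \<gamma>G v, of q] by (simp add: \<gamma>v o)
  have qv: "B q ?v = \<zero>" by (rule perp_sym) (simp_all add: vq)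
  have lines: "?v \<in> transvec_lines N (c \<odot>\<^bsub>M\<^esub> q)"
    by (rule core_transvec_lines[OF N conj core_smult[OF c q] cq]) (simp_all add: form_simps qv)
  have "transvec u (r \<odot>\<^bsub>M\<^esub> (c \<odot>\<^bsub>M\<^esub> \<gamma> q)) \<in> N" if r: "r \<in> carrier R" for r
  proof -
    have "transvec (c \<odot>\<^bsub>M\<^esub> q) (r \<odot>\<^bsub>M\<^esub> ?v) \<in> N" using lines r by (simp add: transvec_lines_def)
    also have "transvec (c \<odot>\<^bsub>M\<^esub> q) (r \<odot>\<^bsub>M\<^esub> ?v) = transvec ?v (r \<odot>\<^bsub>M\<^esub> (c \<odot>\<^bsub>M\<^esub> q))"
      using r transvec_commute[of "c \<odot>\<^bsub>M\<^esub> q" "r \<odot>\<^bsub>M\<^esub> ?v"]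
        transvec_smult[of ?v "c \<odot>\<^bsub>M\<^esub> q" r] by simp
    finally have "\<gamma> \<otimes>\<^bsub>\<G>\<^esub> transvec ?v (r \<odot>\<^bsub>M\<^esub> (c \<odot>\<^bsub>M\<^esub> q)) \<otimes>\<^bsub>\<G>\<^esub> inv\<^bsub>\<G>\<^esub> \<gamma> \<in> N"
      by (rule conj[OF \<gamma>])
    then show ?thesis
      using r by (simp add: transvec_conj \<gamma>G \<gamma>v form_simps vq Sp_smult)
  qed
  then show ?thesis by (simp add: transvec_lines_def perp_def form_simps o Sp_closed[OF \<gamma>G])
qed

text \<open>
  For \<open>a, b\<close> in the image of the core under an elementary \<open>\<gamma>\<close>, the vector \<open>wedge u a b\<close> is itself the
  image of a core vector and is orthogonal to \<open>u\<close>, hence in \<open>S\<close>. Expanding this for three choices of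
  \<open>\<gamma>\<close> gives the remaining pairs. Write \<open>s = \<langle>x, y\<rangle>\<close>.

  With \<open>\<gamma> = transvec d r\<close>, where \<open>d\<close> is \<open>e\<close> or \<open>f\<close>, the core vectors \<open>q\<close> and \<open>q'\<close> are moved to
  \<open>q + \<langle>r, q\<rangle> d\<close> and \<open>q' + \<langle>r, q'\<rangle> d\<close>, so that \<open>wedge u d (\<langle>r, q\<rangle> q' - \<langle>r, q'\<rangle> q) \<in> S\<close>. Taking \<open>r\<close>, \<open>q\<close>,
  \<open>q'\<close> among \<open>x\<close>, \<open>y\<close> and a third vector \<open>z\<close> yields first \<open>s wedge u d y \<in> S\<close> and then
  \<open>s\<^sup>2 wedge u d z \<in> S\<close>.

  The product \<open>transvec f x \<circ> transvec e y\<close> moves \<open>x\<close> and \<open>y\<close> to \<open>(1 + s) x - s e\<close> and \<open>y + s f\<close>; apart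
  from terms already treated, their wedge is \<open>- s\<^sup>2 wedge u e f\<close>.
\<close>
lemma wedge_span:
  assumes S: "submodule S R M" and u[simp]: "u \<in> carrier M"
    and core: "\<And>\<gamma> q. \<gamma> \<in> elementary \<Longrightarrow> q \<in> core \<Longrightarrow> B u (\<gamma> q) = \<zero> \<Longrightarrow> \<gamma> q \<in> S"
    and x: "x \<in> core" and y: "y \<in> core" and a: "a \<in> carrier M" and b: "b \<in> carrier M"
  shows "(B x y \<otimes> B x y) \<odot>\<^bsub>M\<^esub> wedge u a b \<in> S"
proof -
  note xy[simp] = core_closed[OF x] core_orth[OF x] core_closed[OF y] core_orth[OF y]
  note add = submoduleE(5)[OF S] and smult = submoduleE(4)[OF S] and minus = submoduleE(6)[OF S]
  have carrS: "\<And>v. v \<in> S \<Longrightarrow> v \<in> carrier M" using submoduleE(1)[OF S] by auto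
  have diff: "w \<in> S" if "v \<oplus>\<^bsub>M\<^esub> w \<in> S" "v \<in> S" "w \<in> carrier M" for v w
    using add[OF minus[OF that(2)] that(1)] that carrS[OF that(2)] by (simp add: M.r_neg1)
  have sigma: "wedge u (\<gamma> q) (\<gamma> q') \<in> S" if \<gamma>: "\<gamma> \<in> elementary" and q: "q \<in> core" "q' \<in> core" for \<gamma> q q'
  proof -
    note [simp] = core_closed[OF q(1)] core_closed[OF q(2)] Sp_closed[OF elementary_Sp[OF \<gamma>]]
    let ?q = "B (\<gamma> q') u \<odot>\<^bsub>M\<^esub> q \<oplus>\<^bsub>M\<^esub> B u (\<gamma> q) \<odot>\<^bsub>M\<^esub> q'"
    have "wedge u (\<gamma> q) (\<gamma> q') = \<gamma> ?q"
      by (simp add: wedge_def Sp_add[OF elementary_Sp[OF \<gamma>]] Sp_smult[OF elementary_Sp[OF \<gamma>]])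
    moreover have "?q \<in> core" using q by (intro core_add core_smult) simp_all
    moreover have "B u (wedge u (\<gamma> q) (\<gamma> q')) = \<zero>" by (rule wedge_perp) simp_all
    ultimately show ?thesis using core[OF \<gamma>, of ?q] by simp
  qed
  have transvec_core: "transvec d r q = q \<oplus>\<^bsub>M\<^esub> B r q \<odot>\<^bsub>M\<^esub> d"
    if "d \<in> {e, f}" "r \<in> core" "q \<in> core" for d r q
    using that by (auto simp: transvec_apply core_closed core_orth)
  have "\<one>\<^bsub>\<G>\<^esub> \<in> elementary" by (rule subgroup.one_closed[OF elementary_subgroup])
  from sigma[OF this]
  have cc: "wedge u q q' \<in> S" if "q \<in> core" "q' \<in> core" for q q'
    using that by (simp add: Sp_one_eq core_closed)
  have plucker: "wedge u d (B r q \<odot>\<^bsub>M\<^esub> q' \<oplus>\<^bsub>M\<^esub> B q' r \<odot>\<^bsub>M\<^esub> q) \<in> S"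
    if d: "d \<in> {e, f}" and r: "r \<in> core" and q: "q \<in> core" "q' \<in> core" for d r q q'
  proof -
    note [simp] = core_closed[OF q(1)] core_closed[OF q(2)] core_closed[OF r]
    have dM[simp]: "d \<in> carrier M" using d by auto
    have "transvec d r \<in> elementary" using d r by (intro transvec_elementary) (auto simp: core_orth)
    then have "wedge u (q \<oplus>\<^bsub>M\<^esub> B r q \<odot>\<^bsub>M\<^esub> d) (q' \<oplus>\<^bsub>M\<^esub> B r q' \<odot>\<^bsub>M\<^esub> d) \<in> S"
      using sigma[of "transvec d r" q q'] q r d by (simp add: transvec_core)
    also have "wedge u (q \<oplus>\<^bsub>M\<^esub> B r q \<odot>\<^bsub>M\<^esub> d) (q' \<oplus>\<^bsub>M\<^esub> B r q' \<odot>\<^bsub>M\<^esub> d)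
      = wedge u q q' \<oplus>\<^bsub>M\<^esub> (B r q \<odot>\<^bsub>M\<^esub> wedge u d q' \<oplus>\<^bsub>M\<^esub> B q' r \<odot>\<^bsub>M\<^esub> wedge u d q)"
      by (simp add: wedge_add_left wedge_add_right wedge_smult_left wedge_smult_right wedge_self
        wedge_skew[of u d q] form_skew[of r q'] smult_l_minus smult_r_minus M.a_ac)
    finally show ?thesis
      using diff[OF _ cc[OF q]] by (simp add: wedge_add_right wedge_smult_right)
  qed
    \<comment> \<open>the relation above for \<open>r = q' = y'\<close> and \<open>q = x'\<close>, whose second term vanishes\<close>
  have single: "B y' x' \<odot>\<^bsub>M\<^esub> wedge u d y' \<in> S" if "d \<in> {e, f}" "x' \<in> core" "y' \<in> core" for d x' y'
  proof -
    have "wedge u d (B y' x' \<odot>\<^bsub>M\<^esub> y' \<oplus>\<^bsub>M\<^esub> B y' y' \<odot>\<^bsub>M\<^esub> x') \<in> S" by (rule plucker) (use that in auto)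
    then show ?thesis using that by (auto simp: core_closed wedge_smult_right)
  qed
  let ?s = "B x y"
  have yx: "B y x = \<ominus> ?s" by (rule form_skew) simp_all
  have dc: "(?s \<otimes> ?s) \<odot>\<^bsub>M\<^esub> wedge u d z \<in> S" if d: "d \<in> {e, f}" and z: "z \<in> core" for d z
  proof -
    note [simp] = core_closed[OF z]
    have dM[simp]: "d \<in> carrier M" using d by auto
    have "?s \<odot>\<^bsub>M\<^esub> wedge u d (?s \<odot>\<^bsub>M\<^esub> z \<oplus>\<^bsub>M\<^esub> B z x \<odot>\<^bsub>M\<^esub> y) \<in> S"
      by (intro smult plucker d x y z) simp
    also have "?s \<odot>\<^bsub>M\<^esub> wedge u d (?s \<odot>\<^bsub>M\<^esub> z \<oplus>\<^bsub>M\<^esub> B z x \<odot>\<^bsub>M\<^esub> y) =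
        B x z \<odot>\<^bsub>M\<^esub> (B y x \<odot>\<^bsub>M\<^esub> wedge u d y) \<oplus>\<^bsub>M\<^esub> (?s \<otimes> ?s) \<odot>\<^bsub>M\<^esub> wedge u d z"
      by (simp add: wedge_add_right wedge_smult_right smult_r_distr smult_assoc1[symmetric]
        yx form_skew[of x z] R.l_minus R.r_minus R.m_comm M.a_comm)
    finally show ?thesis by (rule diff) (simp_all add: smult single[OF d x y])
  qed
  have ef: "(?s \<otimes> ?s) \<odot>\<^bsub>M\<^esub> wedge u e f \<in> S"
  proof -
    let ?\<gamma> = "transvec f x \<otimes>\<^bsub>\<G>\<^esub> transvec e y"
    let ?x' = "(\<one> \<oplus> ?s) \<odot>\<^bsub>M\<^esub> x"
    have x': "?x' \<in> core" using x by (intro core_smult) simp_all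
    have \<gamma>x: "?\<gamma> x = ?x' \<oplus>\<^bsub>M\<^esub> B y x \<odot>\<^bsub>M\<^esub> e"
    proof -
      have fx: "transvec f x \<in> carrier \<G>" by simp
      have "transvec f x e = e \<oplus>\<^bsub>M\<^esub> \<ominus>\<^bsub>M\<^esub> x" by (simp add: transvec_apply smult_l_minus)
      moreover have "transvec f x x = x" by (simp add: transvec_apply)
      ultimately have "?\<gamma> x = x \<oplus>\<^bsub>M\<^esub> B y x \<odot>\<^bsub>M\<^esub> (e \<oplus>\<^bsub>M\<^esub> \<ominus>\<^bsub>M\<^esub> x)"
        by (simp add: transvec_core x y Sp_add[OF fx] Sp_smult[OF fx])
      then show ?thesis
        by (simp add: yx smult_l_distr smult_r_distr smult_l_minus smult_r_minus M.a_ac)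
    qed
    have \<gamma>y: "?\<gamma> y = y \<oplus>\<^bsub>M\<^esub> ?s \<odot>\<^bsub>M\<^esub> f"
      by (simp add: transvec_core x y)
    have "?\<gamma> \<in> elementary"
      by (intro subgroup.m_closed[OF elementary_subgroup] transvec_elementary) simp_all
    from sigma[OF this x y] 
    have "wedge u (?x' \<oplus>\<^bsub>M\<^esub> B y x \<odot>\<^bsub>M\<^esub> e) (y \<oplus>\<^bsub>M\<^esub> ?s \<odot>\<^bsub>M\<^esub> f) \<in> S"
      unfolding \<gamma>x \<gamma>y .
    also have "wedge u (?x' \<oplus>\<^bsub>M\<^esub> B y x \<odot>\<^bsub>M\<^esub> e) (y \<oplus>\<^bsub>M\<^esub> ?s \<odot>\<^bsub>M\<^esub> f) =
      wedge u ?x' y \<oplus>\<^bsub>M\<^esub> (B y x \<odot>\<^bsub>M\<^esub> wedge u e y \<oplus>\<^bsub>M\<^esub> (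
       \<ominus>\<^bsub>M\<^esub> ((\<one> \<oplus> ?s) \<odot>\<^bsub>M\<^esub> (?s \<odot>\<^bsub>M\<^esub> wedge u f x)) \<oplus>\<^bsub>M\<^esub> (?s \<otimes> B y x) \<odot>\<^bsub>M\<^esub> wedge u e f))"
      by (simp only: wedge_add_left wedge_add_right wedge_smult_left wedge_smult_right 
         u xy e_closed f_closed smult_closed M.a_closed R.a_closed form_closed R.one_closed)
       (simp add: wedge_skew[of u f x] smult_r_minus smult_r_distr smult_assoc1[symmetric] M.a_ac R.m_comm)
    finally have "(?s \<otimes> B y x) \<odot>\<^bsub>M\<^esub> wedge u e f \<in> S"
    proof (rule diff[OF diff[OF diff]])
      show "wedge u ?x' y \<in> S" by (rule cc[OF x' y])
      show "B y x \<odot>\<^bsub>M\<^esub> wedge u e y \<in> S" by (rule single) (simp_all add: x y)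
      have "?s \<odot>\<^bsub>M\<^esub> wedge u f x \<in> S" by (rule single) (simp_all add: x y)
      from this show "\<ominus>\<^bsub>M\<^esub> ((\<one> \<oplus> ?s) \<odot>\<^bsub>M\<^esub> (?s \<odot>\<^bsub>M\<^esub> wedge u f x)) \<in> S" 
        by (intro minus smult[of "\<one> \<oplus> ?s" "?s \<odot>\<^bsub>M\<^esub> wedge u f x"]) simp_all
    qed simp_all
    from minus[OF this] show ?thesis by (simp add: yx R.r_minus smult_l_minus)
  qed
  let ?c = "?s \<otimes> ?s"
  have swap: "?c \<odot>\<^bsub>M\<^esub> wedge u w v \<in> S" if "?c \<odot>\<^bsub>M\<^esub> wedge u v w \<in> S" "v \<in> carrier M" "w \<in> carrier M" for v w
    using minus[OF that(1)] that(2,3) by (simp add: wedge_skew[of u v w] smult_r_minus)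
  have zeroS: "\<zero>\<^bsub>M\<^esub> \<in> S" by (rule submodule_zero[OF S])
  have all: "?c \<odot>\<^bsub>M\<^esub> wedge u v w \<in> S"
    if "w \<in> carrier M" "v \<in> carrier M" "?c \<odot>\<^bsub>M\<^esub> wedge u e w \<in> S" "?c \<odot>\<^bsub>M\<^esub> wedge u f w \<in> S"
      "\<And>z. z \<in> core \<Longrightarrow> ?c \<odot>\<^bsub>M\<^esub> wedge u z w \<in> S" for v w
  proof -
    have "{v \<in> carrier M. ?c \<odot>\<^bsub>M\<^esub> wedge u v w \<in> S} = carrier M"
      by (rule submodule_eq_carrier[OF submodule_wedge_left[OF S]]) (use that core_closed in auto)
    then show ?thesis using that(2) by blast
  qed
  have e_all: "?c \<odot>\<^bsub>M\<^esub> wedge u v e \<in> S" if "v \<in> carrier M" for v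
  proof (rule all)
    show "?c \<odot>\<^bsub>M\<^esub> wedge u z e \<in> S" if "z \<in> core" for z
      by (rule swap[OF dc]) (use that in \<open>simp_all add: core_closed\<close>)
    show "?c \<odot>\<^bsub>M\<^esub> wedge u f e \<in> S" by (rule swap[OF ef]) simp_all
  qed (use that in \<open>simp_all add: wedge_self zeroS\<close>)
  have f_all: "?c \<odot>\<^bsub>M\<^esub> wedge u v f \<in> S" if "v \<in> carrier M" for v
  proof (rule all)
    show "?c \<odot>\<^bsub>M\<^esub> wedge u z f \<in> S" if "z \<in> core" for z
      by (rule swap[OF dc]) (use that in \<open>simp_all add: core_closed\<close>)
  qed (use that in \<open>simp_all add: wedge_self zeroS ef\<close>)
  have core_all: "?c \<odot>\<^bsub>M\<^esub> wedge u v z \<in> S" if "v \<in> carrier M" "z \<in> core" for v z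
    by (rule all) (use that in \<open>simp_all add: core_closed dc smult cc\<close>)
  show ?thesis
  proof (rule all[OF b a])
    show "?c \<odot>\<^bsub>M\<^esub> wedge u e b \<in> S" "?c \<odot>\<^bsub>M\<^esub> wedge u f b \<in> S"
      by (rule swap[OF e_all] swap[OF f_all]; simp add: b)+
    show "?c \<odot>\<^bsub>M\<^esub> wedge u z b \<in> S" if "z \<in> core" for z
      by (rule swap[OF core_all]) (simp_all add: b that core_closed)
  qed
qed

end

section \<open>Ideals and normal closures\<close>

lemma (in cring) ex_maximalideal:
  assumes K: "ideal K R" and ne: "K \<noteq> carrier R"
  obtains m where "maximalideal m R" "K \<subseteq> m"
proof -
  let ?A = "{J. ideal J R \<and> K \<subseteq> J \<and> \<one> \<notin> J}"
  have "\<exists>m\<in>?A. \<forall>J\<in>?A. m \<subseteq> J \<longrightarrow> J = m"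
  proof (rule subset_Zorn_nonempty)
    have "K \<in> ?A" using K ne ideal.one_imp_carrier[OF K] by auto
    then show "?A \<noteq> {}" using equals0D[of ?A K] by argo
  next
    fix C assume C: "C \<noteq> {}" "subset.chain ?A C"
    then have sub: "C \<subseteq> ?A" by (simp add: subset_chain_def)
    have "subset.chain {J. ideal J R} C" using C(2) sub by (simp add: subset_chain_def) blast
    then have "ideal (\<Union>C) R" using chain_Union_is_ideal[of C] C(1) by simp
    then show "\<Union>C \<in> ?A" using sub C(1) by auto
  qed
  then obtain m where m: "m \<in> ?A" and max: "\<forall>J\<in>?A. m \<subseteq> J \<longrightarrow> J = m" by (rule bexE)
  have "maximalideal m R"
  proof (rule maximalidealI)
    show "carrier R \<noteq> m" using m by auto
    show "J = m \<or> J = carrier R" if "ideal J R" "m \<subseteq> J" for J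
      using bspec[OF max, of J] that m ideal.one_imp_carrier[OF that(1)] by auto
  qed (use m in auto)
  moreover have "K \<subseteq> m" using m by blast
  ultimately show ?thesis by (rule that)
qed

lemma (in group) subgroup_conj_preimage:
  assumes N: "subgroup N G" and g[simp]: "g \<in> carrier G"
  shows "subgroup {x \<in> carrier G. g \<otimes> x \<otimes> inv g \<in> N} G"
proof (rule subgroupI)
  show "{x \<in> carrier G. g \<otimes> x \<otimes> inv g \<in> N} \<noteq> {}"
    using subgroup.one_closed[OF N] by (auto intro!: exI[of _ \<one>])
  fix x assume x: "x \<in> {x \<in> carrier G. g \<otimes> x \<otimes> inv g \<in> N}"
  then have [simp]: "x \<in> carrier G" by simp
  have "g \<otimes> inv x \<otimes> inv g = inv (g \<otimes> x \<otimes> inv g)" by (simp add: inv_mult_group m_assoc)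
  then show "inv x \<in> {x \<in> carrier G. g \<otimes> x \<otimes> inv g \<in> N}"
    using x subgroup.m_inv_closed[OF N] by simp
  fix y assume y: "y \<in> {x \<in> carrier G. g \<otimes> x \<otimes> inv g \<in> N}"
  then have [simp]: "y \<in> carrier G" by simp
  have "inv g \<otimes> (g \<otimes> z) = z" if "z \<in> carrier G" for z
    using that by (simp add: m_assoc[symmetric])
  then have "g \<otimes> (x \<otimes> y) \<otimes> inv g = (g \<otimes> x \<otimes> inv g) \<otimes> (g \<otimes> y \<otimes> inv g)"
    by (simp add: m_assoc)
  then show "x \<otimes> y \<in> {x \<in> carrier G. g \<otimes> x \<otimes> inv g \<in> N}"
    using x y subgroup.m_closed[OF N] by simp
qed auto

lemma (in group) generate_normalI:
  assumes T: "T \<subseteq> carrier G"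
    and conj: "\<And>g x. g \<in> carrier G \<Longrightarrow> x \<in> T \<Longrightarrow> g \<otimes> x \<otimes> inv g \<in> generate G T"
  shows "generate G T \<lhd> G"
proof (rule normal_invI)
  show sub: "subgroup (generate G T) G" by (rule generate_is_subgroup[OF T])
  fix g x assume g: "g \<in> carrier G" and x: "x \<in> generate G T"
  have "generate G T \<subseteq> {x \<in> carrier G. g \<otimes> x \<otimes> inv g \<in> generate G T}"
    by (rule generate_subgroup_incl[OF _ subgroup_conj_preimage[OF sub g]]) (use T conj[OF g] in auto)
  then show "g \<otimes> x \<otimes> inv g \<in> generate G T" using x by blast
qed

lemma normal_closure_minimal: "N \<lhd> G \<Longrightarrow> H \<subseteq> N \<Longrightarrow> normal_closure G H \<subseteq> N"
  by (auto simp: normal_closure_def)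

context group begin
context
  fixes E H :: "'a set"
  assumes E: "subgroup E G" and H: "H \<subseteq> E"
begin

lemma normal_closure_superset: "H \<subseteq> normal_closure (G\<lparr>carrier := E\<rparr>) H"
  by (auto simp: normal_closure_def)

lemma normal_closure_conj:
  assumes "x \<in> E" and n: "n \<in> normal_closure (G\<lparr>carrier := E\<rparr>) H"
  shows "x \<otimes> n \<otimes> inv x \<in> normal_closure (G\<lparr>carrier := E\<rparr>) H"
proof -
  have "x \<otimes> n \<otimes> inv x \<in> N" if N: "N \<lhd> G\<lparr>carrier := E\<rparr>" "n \<in> N" for N
    using normal.inv_op_closed2[OF N(1), of x n] N(2) \<open>x \<in> E\<close> by (simp add: m_inv_consistent[OF E])
  then show ?thesis using n by (auto simp: normal_closure_def)
qed

lemma self_normal: "E \<lhd> G\<lparr>carrier := E\<rparr>"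
proof -
  interpret GE: group "G\<lparr>carrier := E\<rparr>" by (rule subgroup.subgroup_is_group[OF E is_group])
  have "subgroup E (G\<lparr>carrier := E\<rparr>)" using GE.subgroup_self by simp
  then show ?thesis
    by (rule GE.normal_invI)
      (simp add: m_inv_consistent[OF E] subgroup.m_closed[OF E] subgroup.m_inv_closed[OF E])
qed

lemma normal_closure_subgroup: "subgroup (normal_closure (G\<lparr>carrier := E\<rparr>) H) G"
proof -
  have "subgroup (\<Inter>{N. N \<lhd> G\<lparr>carrier := E\<rparr> \<and> H \<subseteq> N}) G"
    using incl_subgroup[OF E normal_imp_subgroup] self_normal H by (intro subgroups_Inter) auto
  then show ?thesis by (simp add: normal_closure_def)
qed

end

text \<open>
  The elements of \<open>E\<close> which conjugation by \<open>g\<close> moves into the normal closure \<open>N\<close> form a normal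
  subgroup of \<open>E\<close>, because conjugation by \<open>g\<close> preserves \<open>E\<close> and elements of \<open>E\<close> normalize \<open>N\<close>. By
  minimality it contains \<open>N\<close> as soon as it contains the generators.
\<close>
lemma normal_closure_generate_normal:
  assumes E: "E \<lhd> G" and T: "T \<subseteq> E"
    and conj: "\<And>g x. g \<in> carrier G \<Longrightarrow> x \<in> T \<Longrightarrow>
      g \<otimes> x \<otimes> inv g \<in> normal_closure (G\<lparr>carrier := E\<rparr>) (generate G T)"
  shows "normal_closure (G\<lparr>carrier := E\<rparr>) (generate G T) \<lhd> G"
proof (rule normal_invI)
  let ?N = "normal_closure (G\<lparr>carrier := E\<rparr>) (generate G T)"
  note Es = normal_imp_subgroup[OF E]
  have gen: "generate G T \<subseteq> E" by (rule generate_subgroup_incl[OF T Es])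
  show sub: "subgroup ?N G" by (rule normal_closure_subgroup[OF Es gen])
  fix g n assume g: "g \<in> carrier G" and n: "n \<in> ?N"
  let ?K = "{x \<in> carrier G. g \<otimes> x \<otimes> inv g \<in> ?N}"
  interpret GE: group "G\<lparr>carrier := E\<rparr>" by (rule subgroup.subgroup_is_group[OF Es is_group])
  have K: "subgroup ?K G" by (rule subgroup_conj_preimage[OF sub g])
  have "E \<inter> ?K \<lhd> G\<lparr>carrier := E\<rparr>"
  proof (rule GE.normal_invI)
    show "subgroup (E \<inter> ?K) (G\<lparr>carrier := E\<rparr>)"
      by (rule subgroup_incl[OF subgroups_Inter_pair[OF Es K] Es]) simp
    fix y x assume y: "y \<in> carrier (G\<lparr>carrier := E\<rparr>)" and x: "x \<in> E \<inter> ?K"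
    have yG[simp]: "y \<in> carrier G" using y subgroup.subset[OF Es] by auto
    have xG[simp]: "x \<in> carrier G" using x by auto
    let ?y = "g \<otimes> y \<otimes> inv g"
    have "?y \<in> E" using normal.inv_op_closed2[OF E g] y by simp
    then have "?y \<otimes> (g \<otimes> x \<otimes> inv g) \<otimes> inv ?y \<in> ?N"
      by (rule normal_closure_conj[OF Es gen]) (use x in blast)
    also have "?y \<otimes> (g \<otimes> x \<otimes> inv g) \<otimes> inv ?y = g \<otimes> (y \<otimes> x \<otimes> inv y) \<otimes> inv g"
    proof -
      have "inv g \<otimes> (g \<otimes> z) = z" if "z \<in> carrier G" for z
        using that g by (simp add: m_assoc[symmetric])
      then show ?thesis using g by (simp add: m_assoc inv_mult_group)
    qed
    finally show "y \<otimes>\<^bsub>G\<lparr>carrier := E\<rparr>\<^esub> x \<otimes>\<^bsub>G\<lparr>carrier := E\<rparr>\<^esub> inv\<^bsub>G\<lparr>carrier := E\<rparr>\<^esub> y \<in> E \<inter> ?K"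
      using y x subgroup.m_closed[OF Es] subgroup.m_inv_closed[OF Es]
      by (simp add: m_inv_consistent[OF Es])
  qed
  moreover have "generate G T \<subseteq> E \<inter> ?K"
    by (rule generate_subgroup_incl[OF _ subgroups_Inter_pair[OF Es K]])
      (use T subgroup.subset[OF Es] conj[OF g] in auto)
  ultimately have "?N \<subseteq> E \<inter> ?K" by (rule normal_closure_minimal)
  then have "n \<in> E \<inter> ?K" using n by blast
  then show "g \<otimes> n \<otimes> inv g \<in> ?N" by simp
qed

end

section \<open>Normality in the isometry group\<close>

context hyperbolic_pair begin

text \<open>
  The scalars that multiply all \<open>wedge u a b\<close> into \<open>S\<close> form an ideal which contains the squares of
  the values of the form on the core. It lies in no maximal ideal, so it contains 1; and \<open>w\<close> is the
  value of \<open>wedge u\<close> at \<open>v\<close> and \<open>w\<close>.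
\<close>
lemma unimodular_perp_span:
  assumes S: "submodule S R M" and u: "u \<in> carrier M" and v: "v \<in> carrier M" and uv: "B u v = \<one>"
    and core: "\<And>\<gamma> q. \<gamma> \<in> elementary \<Longrightarrow> q \<in> core \<Longrightarrow> B u (\<gamma> q) = \<zero> \<Longrightarrow> \<gamma> q \<in> S"
    and unit: "\<And>m. maximalideal m R \<Longrightarrow> \<exists>x\<in>core. \<exists>y\<in>core. B x y \<notin> m"
    and w: "w \<in> perp u"
  shows "w \<in> S"
proof -
  let ?K = "{c \<in> carrier R. \<forall>a\<in>carrier M. \<forall>b\<in>carrier M. c \<odot>\<^bsub>M\<^esub> wedge u a b \<in> S}"
  note add = submoduleE(5)[OF S] and smult = submoduleE(4)[OF S] and minus = submoduleE(6)[OF S]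
  have K: "ideal ?K R"
  proof (rule idealI)
    show "subgroup ?K (add_monoid R)"
    proof (rule R.add.subgroupI)
      show "?K \<noteq> {}" using submodule_zero[OF S] u by (auto intro!: exI[of _ "\<zero>"])
    qed (auto simp: u smult_l_distr smult_l_minus add minus simp flip: a_inv_def)
    fix c a assume "c \<in> ?K" "a \<in> carrier R"
    then show "a \<otimes> c \<in> ?K" "c \<otimes> a \<in> ?K"
      by (auto simp: u smult_assoc1 smult R.m_comm[of c a])
  qed (rule R.ring_axioms)
  have "?K = carrier R"
  proof (rule ccontr)
    assume "?K \<noteq> carrier R"
    then obtain m where m: "maximalideal m R" and Km: "?K \<subseteq> m"
      using R.ex_maximalideal[OF K] by blast
    obtain x y where xy: "x \<in> core" "y \<in> core" "B x y \<notin> m" using unit[OF m] by blast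
    have "B x y \<otimes> B x y \<in> ?K"
    proof (intro CollectI conjI ballI)
      fix a b assume "a \<in> carrier M" "b \<in> carrier M"
      with S u _ xy(1,2) show "(B x y \<otimes> B x y) \<odot>\<^bsub>M\<^esub> wedge u a b \<in> S"
        by (rule wedge_span) (rule core)
    qed (simp add: core_closed[OF xy(1)] core_closed[OF xy(2)])
    then have "B x y \<otimes> B x y \<in> m" using Km by blast
    then show False
      using primeideal.I_prime[OF R.maximalideal_prime[OF m], of "B x y" "B x y"] xy(3)
        form_closed[OF core_closed[OF xy(1)] core_closed[OF xy(2)]] by blast
  qed
  then have "\<one> \<odot>\<^bsub>M\<^esub> wedge u v w \<in> S" using v perp_carrier[OF w] by blast
  moreover have "wedge u v w = w"
    using perp_carrier[OF w] w v u perp_sym[of u w] by (simp add: wedge_def uv perp_def)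
  ultimately show ?thesis using perp_carrier[OF w] by simp
qed

text \<open>
  For a fixed scalar \<open>c\<close>, the \<open>w\<close> that satisfy the conclusion form a submodule, to which the spanning
  result applies.
\<close>
lemma perp_transvec_lines:
  assumes N: "subgroup N \<G>"
    and conj: "\<And>\<gamma> \<tau>. \<gamma> \<in> elementary \<Longrightarrow> \<tau> \<in> N \<Longrightarrow> \<gamma> \<otimes>\<^bsub>\<G>\<^esub> \<tau> \<otimes>\<^bsub>\<G>\<^esub> inv\<^bsub>\<G>\<^esub> \<gamma> \<in> N"
    and unit: "\<And>m. maximalideal m R \<Longrightarrow> \<exists>x\<in>core. \<exists>y\<in>core. B x y \<notin> m"
    and c: "c \<in> carrier R"
    and gens: "\<And>r d q. r \<in> carrier R \<Longrightarrow> d \<in> {e, f} \<Longrightarrow> q \<in> core \<Longrightarrow> transvec d ((r \<otimes> c) \<odot>\<^bsub>M\<^esub> q) \<in> N"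
    and u[simp]: "u \<in> carrier M" and v: "v \<in> carrier M" "B u v = \<one>" and w: "w \<in> perp u"
  shows "c \<odot>\<^bsub>M\<^esub> w \<in> transvec_lines N u"
proof -
  let ?S = "{w \<in> carrier M. c \<odot>\<^bsub>M\<^esub> w \<in> transvec_lines N u}"
  note L = submodule_transvec_lines[OF N u]
  have S: "submodule ?S R M"
  proof (rule submoduleI')
    show "\<zero>\<^bsub>M\<^esub> \<in> ?S" using submodule_zero[OF L] c by simp
  next
    fix a x assume "a \<in> carrier R" "x \<in> ?S"
    then show "a \<odot>\<^bsub>M\<^esub> x \<in> ?S"
      using submoduleE(4)[OF L, of a "c \<odot>\<^bsub>M\<^esub> x"] c by (simp add: smult_assoc1[symmetric] R.m_comm)
  qed (use c submoduleE(5)[OF L] in \<open>auto simp: smult_r_distr\<close>)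
  have "w \<in> ?S"
  proof (rule unimodular_perp_span[OF S u v _ unit w])
    fix \<gamma> q assume \<gamma>: "\<gamma> \<in> elementary" and q: "q \<in> core" and o: "B u (\<gamma> q) = \<zero>"
    have "c \<odot>\<^bsub>M\<^esub> q \<in> transvec_lines N d" if "d \<in> {e, f}" for d
      using gens[OF _ that q] that q c
      by (auto simp: transvec_lines_def perp_def core_closed core_orth form_simps smult_assoc1)
    then show "\<gamma> q \<in> ?S"
      using transvec_lines_conj[OF N conj q c _ _ u \<gamma> o] Sp_closed[OF elementary_Sp[OF \<gamma>] core_closed[OF q]]
      by simp
  qed
  then show ?thesis by simp
qed

lemma Sp_pair_dual:
  assumes g: "g \<in> carrier \<G>" and d: "d \<in> {e, f}"
  obtains v where "v \<in> carrier M" "B (g d) v = \<one>"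
proof (cases "d = e")
  case True
  then show ?thesis using that[of "g f"] g by (simp add: Sp_closed Sp_form)
next
  case False
  then show ?thesis
    using that[of "g ((\<ominus> \<one>) \<odot>\<^bsub>M\<^esub> e)"] g d by (auto simp: Sp_closed Sp_form form_simps R.r_minus)
qed

text \<open>
  The case of the unit ideal: here \<open>N\<close> is the elementary group itself and \<open>c = 1\<close>.
\<close>
lemma elementary_normal:
  assumes unit: "\<And>m. maximalideal m R \<Longrightarrow> \<exists>x\<in>core. \<exists>y\<in>core. B x y \<notin> m"
  shows "elementary \<lhd> \<G>"
  unfolding elementary_def
proof (rule Sp.generate_normalI[OF elementary_gens], fold elementary_def)
  fix g \<tau> assume g: "g \<in> carrier \<G>" and "\<tau> \<in> transvec e ` perp e \<union> transvec f ` perp f"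
  then obtain d w where d: "d \<in> {e, f}" and w: "w \<in> perp d" and \<tau>: "\<tau> = transvec d w" by blast
  have dM: "d \<in> carrier M" using d by auto
  note wM = perp_carrier[OF w]
  have dw: "B d w = \<zero>" using w by (simp add: perp_def)
  obtain v where v: "v \<in> carrier M" "B (g d) v = \<one>" using Sp_pair_dual[OF g d] .
  have "\<one> \<odot>\<^bsub>M\<^esub> g w \<in> transvec_lines elementary (g d)"
  proof (rule perp_transvec_lines[OF elementary_subgroup _ unit _ _ _ v])
    show "\<gamma> \<otimes>\<^bsub>\<G>\<^esub> \<tau> \<otimes>\<^bsub>\<G>\<^esub> inv\<^bsub>\<G>\<^esub> \<gamma> \<in> elementary" if "\<gamma> \<in> elementary" "\<tau> \<in> elementary" for \<gamma> \<tau>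
      using that subgroup.m_closed[OF elementary_subgroup] subgroup.m_inv_closed[OF elementary_subgroup] by blast
    show "g w \<in> perp (g d)" using g dM wM dw by (simp add: perp_def Sp_form Sp_closed)
    show "transvec d' ((r \<otimes> \<one>) \<odot>\<^bsub>M\<^esub> q) \<in> elementary" if "r \<in> carrier R" "d' \<in> {e, f}" "q \<in> core" for r d' q
      using that by (intro transvec_elementary) (auto simp: core_closed core_orth form_simps)
  qed (simp_all add: Sp_closed[OF g dM])
  then have "transvec (g d) (\<one> \<odot>\<^bsub>M\<^esub> (\<one> \<odot>\<^bsub>M\<^esub> g w)) \<in> elementary"
    by (simp only: transvec_lines_def mem_Collect_eq R.one_closed)
  then show "g \<otimes>\<^bsub>\<G>\<^esub> \<tau> \<otimes>\<^bsub>\<G>\<^esub> inv\<^bsub>\<G>\<^esub> g \<in> elementary"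
    by (simp add: \<tau> transvec_conj g dM wM dw Sp_closed)
qed

text \<open>
  The set \<open>T\<close> plays the role of the generators of the relative group for \<open>I\<close>. It has to contain enough
  transvections for \<open>N\<close> to satisfy the assumptions of \<open>perp_transvec_lines\<close>, and not more than
  transvections whose second argument is an \<open>I\<close>-combination of vectors orthogonal to the first; that
  span is expressed by quantification over the submodules \<open>H\<close>.
\<close>
theorem relative_elementary_normal:
  assumes unit: "\<And>m. maximalideal m R \<Longrightarrow> \<exists>x\<in>core. \<exists>y\<in>core. B x y \<notin> m"
    and I: "ideal I R"
    and T_core: "\<And>c d q. c \<in> I \<Longrightarrow> d \<in> {e, f} \<Longrightarrow> q \<in> core \<Longrightarrow> transvec d (c \<odot>\<^bsub>M\<^esub> q) \<in> T"
    and T_span: "\<And>x. x \<in> T \<Longrightarrow> \<exists>d\<in>{e, f}. \<exists>w\<in>perp d. x = transvec d w \<and>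
      (\<forall>H. submodule H R M \<longrightarrow> (\<forall>c\<in>I. \<forall>z\<in>perp d. c \<odot>\<^bsub>M\<^esub> z \<in> H) \<longrightarrow> w \<in> H)"
  shows "normal_closure (\<G>\<lparr>carrier := elementary\<rparr>) (generate \<G> T) \<lhd> \<G>"
proof (rule Sp.normal_closure_generate_normal)
  show "elementary \<lhd> \<G>" by (rule elementary_normal[OF unit])
  show T: "T \<subseteq> elementary"
    using T_span by (fastforce simp: elementary_def intro!: generate.incl)
  let ?N = "normal_closure (\<G>\<lparr>carrier := elementary\<rparr>) (generate \<G> T)"
  have gen: "generate \<G> T \<subseteq> elementary"
    by (rule Sp.generate_subgroup_incl[OF T elementary_subgroup])
  have N: "subgroup ?N \<G>" by (rule Sp.normal_closure_subgroup[OF elementary_subgroup gen])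
  have IR: "\<And>c. c \<in> I \<Longrightarrow> c \<in> carrier R" using ideal.Icarr[OF I] .
  have XN: "x \<in> ?N" if "x \<in> T" for x
    by (rule subsetD[OF Sp.normal_closure_superset[OF elementary_subgroup gen]]) (rule generate.incl[OF that])
  fix g x assume g: "g \<in> carrier \<G>" and xT: "x \<in> T"
  from T_span[OF xT] obtain d w where d: "d \<in> {e, f}" and w: "w \<in> perp d" and x: "x = transvec d w"
    and span: "\<forall>H. submodule H R M \<longrightarrow> (\<forall>c\<in>I. \<forall>z\<in>perp d. c \<odot>\<^bsub>M\<^esub> z \<in> H) \<longrightarrow> w \<in> H"
    by (elim bexE conjE)
  have dM: "d \<in> carrier M" using d by auto
  note wM = perp_carrier[OF w] and gd = Sp_closed[OF g dM]
  have dw: "B d w = \<zero>" using w by (simp add: perp_def)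
  obtain v where v: "v \<in> carrier M" "B (g d) v = \<one>" using Sp_pair_dual[OF g d] .
  note L = submodule_transvec_lines[OF N gd]
  have "w \<in> {z \<in> carrier M. g z \<in> transvec_lines ?N (g d)}"
  proof (rule span[rule_format])
    show "submodule {z \<in> carrier M. g z \<in> transvec_lines ?N (g d)} R M"
    proof (rule submoduleI')
      have "g \<zero>\<^bsub>M\<^esub> = \<zero>\<^bsub>M\<^esub>" using Sp_smult[OF g, of \<zero> "\<zero>\<^bsub>M\<^esub>"] Sp_closed[OF g] by simp
      then show "\<zero>\<^bsub>M\<^esub> \<in> {z \<in> carrier M. g z \<in> transvec_lines ?N (g d)}" using submodule_zero[OF L] by simp
    qed (auto simp: Sp_add[OF g] Sp_smult[OF g] submoduleE(4,5)[OF L])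
    fix c z assume c: "c \<in> I" and z: "z \<in> perp d"
    note zM = perp_carrier[OF z]
    have "c \<odot>\<^bsub>M\<^esub> g z \<in> transvec_lines ?N (g d)"
    proof (rule perp_transvec_lines[OF N _ unit IR[OF c] _ gd v])
      show "\<gamma> \<otimes>\<^bsub>\<G>\<^esub> \<tau> \<otimes>\<^bsub>\<G>\<^esub> inv\<^bsub>\<G>\<^esub> \<gamma> \<in> ?N" if "\<gamma> \<in> elementary" "\<tau> \<in> ?N" for \<gamma> \<tau>
        by (rule Sp.normal_closure_conj[OF elementary_subgroup gen that])
      show "g z \<in> perp (g d)" using g dM z zM by (simp add: perp_def Sp_form Sp_closed)
      show "transvec d' ((r \<otimes> c) \<odot>\<^bsub>M\<^esub> q) \<in> ?N" if "r \<in> carrier R" "d' \<in> {e, f}" "q \<in> core" for r d' q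
        by (intro XN T_core that ideal.I_l_closed[OF I c])
    qed
    then show "c \<odot>\<^bsub>M\<^esub> z \<in> {z \<in> carrier M. g z \<in> transvec_lines ?N (g d)}"
      using zM IR[OF c] by (simp add: Sp_smult[OF g])
  qed
  then have "transvec (g d) (\<one> \<odot>\<^bsub>M\<^esub> g w) \<in> ?N"
    by (simp only: transvec_lines_def mem_Collect_eq R.one_closed)
  then show "g \<otimes>\<^bsub>\<G>\<^esub> x \<otimes>\<^bsub>\<G>\<^esub> inv\<^bsub>\<G>\<^esub> g \<in> ?N"
    by (simp add: x transvec_conj g dM wM dw Sp_closed)
qed

end

section \<open>Localization\<close>

lemma (in cring) module_regular: "module R (regular_module R)"
proof (rule moduleI)
  show "abelian_group (regular_module R)"
    by (rule abelian_groupI) (auto simp: regular_module_def a_assoc intro: a_comm l_neg exI[of _ "\<ominus> _"] bexI[of _ "\<ominus> _"])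
qed (auto simp: regular_module_def is_cring l_distr r_distr m_assoc)

text \<open>
  The operations on fractions are unions over all representatives. This removes the unions once
  independence of the representatives is known.
\<close>
lemma UN_UN_const:
  assumes "U \<noteq> {}" "V \<noteq> {}" "\<And>x s y t. (x, s) \<in> U \<Longrightarrow> (y, t) \<in> V \<Longrightarrow> F x s y t = C"
  shows "(\<Union>(x, s)\<in>U. \<Union>(y, t)\<in>V. F x s y t) = C"
  using assms by fastforce

locale localization = module R M for R (structure) and M (structure) +
  fixes S :: "'a set"
  assumes S_subset: "S \<subseteq> carrier R" and S_one [simp]: "\<one> \<in> S"
    and S_mult [simp]: "\<And>s t. s \<in> S \<Longrightarrow> t \<in> S \<Longrightarrow> s \<otimes> t \<in> S"
begin

lemma S_carrier [simp]: "s \<in> S \<Longrightarrow> s \<in> carrier R"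
  using S_subset by auto

abbreviation frac where "frac \<equiv> loc_frac R S M"

lemma loc_rel_iff: "((x, s), (y, t)) \<in> loc_rel R S M \<longleftrightarrow>
    x \<in> carrier M \<and> s \<in> S \<and> y \<in> carrier M \<and> t \<in> S \<and> (\<exists>u\<in>S. (u \<otimes> t) \<odot>\<^bsub>M\<^esub> x = (u \<otimes> s) \<odot>\<^bsub>M\<^esub> y)"
  by (auto simp: loc_rel_def smult_assoc1)

lemma equiv_loc_rel: "equiv (carrier M \<times> S) (loc_rel R S M)"
proof (rule equivI)
  show "loc_rel R S M \<subseteq> (carrier M \<times> S) \<times> carrier M \<times> S" by (auto simp: loc_rel_iff)
  show "refl_on (carrier M \<times> S) (loc_rel R S M)" by (rule refl_onI) (auto simp: loc_rel_iff)
  show "sym (loc_rel R S M)" by (rule symI) (clarsimp simp: loc_rel_iff, metis)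
  show "trans (loc_rel R S M)"
  proof (rule transI, clarsimp simp: loc_rel_iff)
    fix x s y t z r u v
    assume [simp]: "x \<in> carrier M" "s \<in> S" "y \<in> carrier M" "t \<in> S" "z \<in> carrier M" "r \<in> S" "u \<in> S" "v \<in> S"
      and 1: "(u \<otimes> t) \<odot>\<^bsub>M\<^esub> x = (u \<otimes> s) \<odot>\<^bsub>M\<^esub> y" and 2: "(v \<otimes> r) \<odot>\<^bsub>M\<^esub> y = (v \<otimes> t) \<odot>\<^bsub>M\<^esub> z"
    have "((u \<otimes> v \<otimes> t) \<otimes> r) \<odot>\<^bsub>M\<^esub> x = (v \<otimes> r) \<odot>\<^bsub>M\<^esub> ((u \<otimes> t) \<odot>\<^bsub>M\<^esub> x)"
      by (simp add: smult_assoc1[symmetric] R.m_ac)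
    also have "\<dots> = (u \<otimes> s) \<odot>\<^bsub>M\<^esub> ((v \<otimes> r) \<odot>\<^bsub>M\<^esub> y)"
      unfolding 1 by (simp add: smult_assoc1[symmetric] R.m_ac)
    also have "\<dots> = ((u \<otimes> v \<otimes> t) \<otimes> s) \<odot>\<^bsub>M\<^esub> z"
      unfolding 2 by (simp add: smult_assoc1[symmetric] R.m_ac)
    finally show "\<exists>w\<in>S. (w \<otimes> r) \<odot>\<^bsub>M\<^esub> x = (w \<otimes> s) \<odot>\<^bsub>M\<^esub> z"
      by (intro bexI[of _ "u \<otimes> v \<otimes> t"]) simp_all
  qed
qed

lemma frac_eq_iff:
  "x \<in> carrier M \<Longrightarrow> s \<in> S \<Longrightarrow> y \<in> carrier M \<Longrightarrow> t \<in> S \<Longrightarrow>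
    frac x s = frac y t \<longleftrightarrow> (\<exists>u\<in>S. (u \<otimes> t) \<odot>\<^bsub>M\<^esub> x = (u \<otimes> s) \<odot>\<^bsub>M\<^esub> y)"
  unfolding loc_frac_def
  by (subst eq_equiv_class_iff[OF equiv_loc_rel]) (auto simp: loc_rel_iff)

lemma frac_eqI:
  assumes "x \<in> carrier M" "s \<in> S" "y \<in> carrier M" "t \<in> S" "t \<odot>\<^bsub>M\<^esub> x = s \<odot>\<^bsub>M\<^esub> y"
  shows "frac x s = frac y t"
  using assms by (simp add: frac_eq_iff) (auto intro!: bexI[of _ \<one>])

lemma mem_fracD:
  "(y, t) \<in> frac x s \<Longrightarrow> x \<in> carrier M \<and> s \<in> S \<and> y \<in> carrier M \<and> t \<in> S \<and> (\<exists>u\<in>S. (u \<otimes> t) \<odot>\<^bsub>M\<^esub> x = (u \<otimes> s) \<odot>\<^bsub>M\<^esub> y)"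
  by (simp add: loc_frac_def loc_rel_iff)

lemma frac_nonempty: "x \<in> carrier M \<Longrightarrow> s \<in> S \<Longrightarrow> frac x s \<noteq> {}"
  using equiv_class_self[OF equiv_loc_rel, of "(x, s)"] by (auto simp: loc_frac_def)

lemma carrier_loc_module: "carrier (loc_module R S M) = {frac x s | x s. x \<in> carrier M \<and> s \<in> S}"
  by (auto simp: loc_module_def quotient_def loc_frac_def)

lemma frac_closed [simp]: "x \<in> carrier M \<Longrightarrow> s \<in> S \<Longrightarrow> frac x s \<in> carrier (loc_module R S M)"
  by (auto simp: carrier_loc_module)

lemma loc_add_frac:
  assumes [simp]: "x \<in> carrier M" "s \<in> S" "y \<in> carrier M" "t \<in> S"
  shows "frac x s \<oplus>\<^bsub>loc_module R S M\<^esub> frac y t = frac (t \<odot>\<^bsub>M\<^esub> x \<oplus>\<^bsub>M\<^esub> s \<odot>\<^bsub>M\<^esub> y) (s \<otimes> t)"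
proof -
  have "(\<Union>(x, s)\<in>frac x s. \<Union>(y, t)\<in>frac y t. frac (t \<odot>\<^bsub>M\<^esub> x \<oplus>\<^bsub>M\<^esub> s \<odot>\<^bsub>M\<^esub> y) (s \<otimes> t))
    = frac (t \<odot>\<^bsub>M\<^esub> x \<oplus>\<^bsub>M\<^esub> s \<odot>\<^bsub>M\<^esub> y) (s \<otimes> t)"
  proof (rule UN_UN_const)
    fix x' s' y' t' assume xs: "(x', s') \<in> frac x s" and yt: "(y', t') \<in> frac y t"
    note [simp] = mem_fracD[OF xs, THEN conjunct2, THEN conjunct2, THEN conjunct1]
      mem_fracD[OF xs, THEN conjunct2, THEN conjunct2, THEN conjunct2, THEN conjunct1]
      mem_fracD[OF yt, THEN conjunct2, THEN conjunct2, THEN conjunct1]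
      mem_fracD[OF yt, THEN conjunct2, THEN conjunct2, THEN conjunct2, THEN conjunct1]
    obtain u v where [simp]: "u \<in> S" "v \<in> S"
      and 1: "(u \<otimes> s') \<odot>\<^bsub>M\<^esub> x = (u \<otimes> s) \<odot>\<^bsub>M\<^esub> x'" and 2: "(v \<otimes> t') \<odot>\<^bsub>M\<^esub> y = (v \<otimes> t) \<odot>\<^bsub>M\<^esub> y'"
      using mem_fracD[OF xs] mem_fracD[OF yt] by blast
    have "((u \<otimes> v) \<otimes> (s \<otimes> t)) \<odot>\<^bsub>M\<^esub> (t' \<odot>\<^bsub>M\<^esub> x' \<oplus>\<^bsub>M\<^esub> s' \<odot>\<^bsub>M\<^esub> y')
      = (v \<otimes> t \<otimes> t') \<odot>\<^bsub>M\<^esub> ((u \<otimes> s) \<odot>\<^bsub>M\<^esub> x') \<oplus>\<^bsub>M\<^esub> (u \<otimes> s \<otimes> s') \<odot>\<^bsub>M\<^esub> ((v \<otimes> t) \<odot>\<^bsub>M\<^esub> y')"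
      by (simp add: smult_r_distr smult_assoc1[symmetric] R.m_ac)
    also have "\<dots> = ((u \<otimes> v) \<otimes> (s' \<otimes> t')) \<odot>\<^bsub>M\<^esub> (t \<odot>\<^bsub>M\<^esub> x \<oplus>\<^bsub>M\<^esub> s \<odot>\<^bsub>M\<^esub> y)"
      unfolding 1[symmetric] 2[symmetric] by (simp add: smult_r_distr smult_assoc1[symmetric] R.m_ac)
    finally show "frac (t' \<odot>\<^bsub>M\<^esub> x' \<oplus>\<^bsub>M\<^esub> s' \<odot>\<^bsub>M\<^esub> y') (s' \<otimes> t') = frac (t \<odot>\<^bsub>M\<^esub> x \<oplus>\<^bsub>M\<^esub> s \<odot>\<^bsub>M\<^esub> y) (s \<otimes> t)"
      by (subst frac_eq_iff) (auto intro!: bexI[of _ "u \<otimes> v"])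
  qed (simp_all add: frac_nonempty)
  then show ?thesis by (simp add: loc_module_def)
qed

lemma loc_abelian_group: "abelian_group (loc_module R S M)"
proof (rule abelian_groupI)
  have zero: "\<zero>\<^bsub>loc_module R S M\<^esub> = frac \<zero>\<^bsub>M\<^esub> \<one>" by (simp add: loc_module_def)
  show "\<zero>\<^bsub>loc_module R S M\<^esub> \<in> carrier (loc_module R S M)" by (simp add: zero)
  show "x \<oplus>\<^bsub>loc_module R S M\<^esub> y \<in> carrier (loc_module R S M)"
    if "x \<in> carrier (loc_module R S M)" "y \<in> carrier (loc_module R S M)" for x y
    using that unfolding carrier_loc_module by (fastforce simp: loc_add_frac)
  show "x \<oplus>\<^bsub>loc_module R S M\<^esub> y \<oplus>\<^bsub>loc_module R S M\<^esub> z = x \<oplus>\<^bsub>loc_module R S M\<^esub> (y \<oplus>\<^bsub>loc_module R S M\<^esub> z)"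
    if "x \<in> carrier (loc_module R S M)" "y \<in> carrier (loc_module R S M)" "z \<in> carrier (loc_module R S M)" for x y z
    using that unfolding carrier_loc_module
    by (auto simp: loc_add_frac smult_r_distr smult_assoc1[symmetric] R.m_ac M.a_assoc)
  show "x \<oplus>\<^bsub>loc_module R S M\<^esub> y = y \<oplus>\<^bsub>loc_module R S M\<^esub> x"
    if "x \<in> carrier (loc_module R S M)" "y \<in> carrier (loc_module R S M)" for x y
    using that unfolding carrier_loc_module
    by (auto simp: loc_add_frac R.m_comm M.a_comm)
  show "\<zero>\<^bsub>loc_module R S M\<^esub> \<oplus>\<^bsub>loc_module R S M\<^esub> x = x" if "x \<in> carrier (loc_module R S M)" for x
    using that unfolding carrier_loc_module by (auto simp: zero loc_add_frac)
  show "\<exists>y\<in>carrier (loc_module R S M). y \<oplus>\<^bsub>loc_module R S M\<^esub> x = \<zero>\<^bsub>loc_module R S M\<^esub>"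
    if x: "x \<in> carrier (loc_module R S M)" for x
  proof -
    obtain a s where as[simp]: "a \<in> carrier M" "s \<in> S" and x: "x = frac a s"
      using x unfolding carrier_loc_module by blast
    have "frac (\<ominus>\<^bsub>M\<^esub> a) s \<oplus>\<^bsub>loc_module R S M\<^esub> x = frac \<zero>\<^bsub>M\<^esub> \<one>"
      unfolding x by (simp add: loc_add_frac smult_r_minus M.l_neg) (rule frac_eqI; simp)
    then show ?thesis unfolding zero by (intro bexI[of _ "frac (\<ominus>\<^bsub>M\<^esub> a) s"]) simp_all
  qed
qed

end

text \<open>
  The base ring, considered as a module over itself, gives the underlying module of the localized
  ring.
\<close>
locale ring_localization = localization R "regular_module R" S for R (structure) and S
begin

lemma regular_simps [simp]:
  "carrier (regular_module R) = carrier R" "a \<oplus>\<^bsub>regular_module R\<^esub> b = a \<oplus> b"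
  "a \<odot>\<^bsub>regular_module R\<^esub> b = a \<otimes> b" "\<zero>\<^bsub>regular_module R\<^esub> = \<zero>"
  by (simp_all add: regular_module_def)

end

context localization begin

sublocale base: ring_localization R S
  by (intro ring_localization.intro localization.intro localization_axioms.intro R.module_regular) (simp_all add: S_subset)

lemma loc_smult_frac:
  assumes [simp]: "a \<in> carrier R" "s \<in> S" "x \<in> carrier M" "t \<in> S"
  shows "base.frac a s \<odot>\<^bsub>loc_module R S M\<^esub> frac x t = frac (a \<odot>\<^bsub>M\<^esub> x) (s \<otimes> t)"
proof -
  have "(\<Union>(a, s)\<in>base.frac a s. \<Union>(x, t)\<in>frac x t. frac (a \<odot>\<^bsub>M\<^esub> x) (s \<otimes> t)) = frac (a \<odot>\<^bsub>M\<^esub> x) (s \<otimes> t)"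
  proof (rule UN_UN_const)
    fix a' s' x' t' assume as: "(a', s') \<in> base.frac a s" and xt: "(x', t') \<in> frac x t"
    obtain u v where uv[simp]: "a' \<in> carrier R" "s' \<in> S" "x' \<in> carrier M" "t' \<in> S" "u \<in> S" "v \<in> S"
      and 1: "u \<otimes> s' \<otimes> a = u \<otimes> s \<otimes> a'" and 2: "(v \<otimes> t') \<odot>\<^bsub>M\<^esub> x = (v \<otimes> t) \<odot>\<^bsub>M\<^esub> x'"
      using base.mem_fracD[OF as] mem_fracD[OF xt] by auto
    have "((u \<otimes> v) \<otimes> (s \<otimes> t)) \<odot>\<^bsub>M\<^esub> (a' \<odot>\<^bsub>M\<^esub> x') = (u \<otimes> s \<otimes> a') \<odot>\<^bsub>M\<^esub> ((v \<otimes> t) \<odot>\<^bsub>M\<^esub> x')"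
      by (simp add: smult_assoc1[symmetric] R.m_ac)
    also have "\<dots> = ((u \<otimes> v) \<otimes> (s' \<otimes> t')) \<odot>\<^bsub>M\<^esub> (a \<odot>\<^bsub>M\<^esub> x)"
      unfolding 1[symmetric] 2[symmetric] by (simp add: smult_assoc1[symmetric] R.m_ac)
    finally show "frac (a' \<odot>\<^bsub>M\<^esub> x') (s' \<otimes> t') = frac (a \<odot>\<^bsub>M\<^esub> x) (s \<otimes> t)"
      by (subst frac_eq_iff) (auto intro!: bexI[of _ "u \<otimes> v"])
  qed (simp_all add: frac_nonempty base.frac_nonempty)
  then show ?thesis by (simp add: loc_module_def)
qed

lemma loc_smult_closed:
  "A \<in> carrier (loc_module R S (regular_module R)) \<Longrightarrow> U \<in> carrier (loc_module R S M) \<Longrightarrow>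
    A \<odot>\<^bsub>loc_module R S M\<^esub> U \<in> carrier (loc_module R S M)"
  unfolding carrier_loc_module base.carrier_loc_module by (fastforce simp: loc_smult_frac)

end

context ring_localization begin

lemma loc_ring_simps:
  "carrier (loc_ring R S) = {frac a s | a s. a \<in> carrier R \<and> s \<in> S}"
  "\<zero>\<^bsub>loc_ring R S\<^esub> = frac \<zero> \<one>" "\<one>\<^bsub>loc_ring R S\<^esub> = frac \<one> \<one>"
  using carrier_loc_module by (simp_all add: loc_ring_def Let_def loc_module_def)

lemma loc_ring_frac_closed [simp]: "a \<in> carrier R \<Longrightarrow> s \<in> S \<Longrightarrow> frac a s \<in> carrier (loc_ring R S)"
  by (auto simp: loc_ring_simps)

lemma loc_ring_add:
  "a \<in> carrier R \<Longrightarrow> s \<in> S \<Longrightarrow> b \<in> carrier R \<Longrightarrow> t \<in> S \<Longrightarrow>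
    frac a s \<oplus>\<^bsub>loc_ring R S\<^esub> frac b t = frac (t \<otimes> a \<oplus> s \<otimes> b) (s \<otimes> t)"
  using loc_add_frac[of a s b t] by (simp add: loc_ring_def Let_def)

lemma loc_ring_mult:
  "a \<in> carrier R \<Longrightarrow> s \<in> S \<Longrightarrow> b \<in> carrier R \<Longrightarrow> t \<in> S \<Longrightarrow>
    frac a s \<otimes>\<^bsub>loc_ring R S\<^esub> frac b t = frac (a \<otimes> b) (s \<otimes> t)"
  using loc_smult_frac[of a s b t] by (simp add: loc_ring_def Let_def)

lemma loc_ring_frac_eqI:
  "a \<in> carrier R \<Longrightarrow> s \<in> S \<Longrightarrow> b \<in> carrier R \<Longrightarrow> t \<in> S \<Longrightarrow> t \<otimes> a = s \<otimes> b \<Longrightarrow> frac a s = frac b t"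
  using frac_eqI[of a s b t] by simp

lemma loc_cring: "cring (loc_ring R S)"
proof (rule cringI)
  interpret L: abelian_group "loc_module R S (regular_module R)" by (rule loc_abelian_group)
  have eq: "carrier (loc_ring R S) = carrier (loc_module R S (regular_module R))"
    "x \<oplus>\<^bsub>loc_ring R S\<^esub> y = x \<oplus>\<^bsub>loc_module R S (regular_module R)\<^esub> y"
    "\<zero>\<^bsub>loc_ring R S\<^esub> = \<zero>\<^bsub>loc_module R S (regular_module R)\<^esub>" for x y
    by (simp_all add: loc_ring_def Let_def)
  show "abelian_group (loc_ring R S)"
    by (rule abelian_groupI) (auto simp: eq L.a_ac intro: L.l_neg bexI[of _ "\<ominus>\<^bsub>loc_module R S (regular_module R)\<^esub> _"])
  show "Group.comm_monoid (loc_ring R S)"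
  proof (rule Group.comm_monoidI)
    show "x \<otimes>\<^bsub>loc_ring R S\<^esub> y \<in> carrier (loc_ring R S)"
      if "x \<in> carrier (loc_ring R S)" "y \<in> carrier (loc_ring R S)" for x y
      using that unfolding loc_ring_simps by (fastforce simp: loc_ring_mult)
    show "\<one>\<^bsub>loc_ring R S\<^esub> \<in> carrier (loc_ring R S)" by (simp add: loc_ring_simps(3))
    show "x \<otimes>\<^bsub>loc_ring R S\<^esub> y \<otimes>\<^bsub>loc_ring R S\<^esub> z = x \<otimes>\<^bsub>loc_ring R S\<^esub> (y \<otimes>\<^bsub>loc_ring R S\<^esub> z)"
      if "x \<in> carrier (loc_ring R S)" "y \<in> carrier (loc_ring R S)" "z \<in> carrier (loc_ring R S)" for x y z
      using that unfolding loc_ring_simps by (auto simp: loc_ring_mult R.m_assoc)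
    show "\<one>\<^bsub>loc_ring R S\<^esub> \<otimes>\<^bsub>loc_ring R S\<^esub> x = x" if "x \<in> carrier (loc_ring R S)" for x
      using that unfolding loc_ring_simps by (auto simp: loc_ring_mult)
    show "x \<otimes>\<^bsub>loc_ring R S\<^esub> y = y \<otimes>\<^bsub>loc_ring R S\<^esub> x"
      if "x \<in> carrier (loc_ring R S)" "y \<in> carrier (loc_ring R S)" for x y
      using that unfolding loc_ring_simps by (auto simp: loc_ring_mult R.m_comm)
  qed
  show "(x \<oplus>\<^bsub>loc_ring R S\<^esub> y) \<otimes>\<^bsub>loc_ring R S\<^esub> z = x \<otimes>\<^bsub>loc_ring R S\<^esub> z \<oplus>\<^bsub>loc_ring R S\<^esub> y \<otimes>\<^bsub>loc_ring R S\<^esub> z"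
    if xyz: "x \<in> carrier (loc_ring R S)" "y \<in> carrier (loc_ring R S)" "z \<in> carrier (loc_ring R S)" for x y z
  proof -
    obtain a s b t c r where [simp]: "a \<in> carrier R" "s \<in> S" "b \<in> carrier R" "t \<in> S" "c \<in> carrier R" "r \<in> S"
      and x: "x = frac a s" and y: "y = frac b t" and z: "z = frac c r"
      using xyz unfolding loc_ring_simps by blast
    show ?thesis unfolding x y z
      by (simp add: loc_ring_add loc_ring_mult, rule loc_ring_frac_eqI)
        (simp_all add: R.l_distr R.r_distr R.m_ac)
  qed
qed

end

lemma (in cring) primeideal_localization:
  assumes m: "primeideal m R"
  shows "ring_localization R (carrier R - m)"
proof -
  interpret m: primeideal m R by fact
  have "\<one> \<notin> m" using m.one_imp_carrier m.I_notcarr by blast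
  then show ?thesis
    by (intro ring_localization.intro localization.intro localization_axioms.intro module_regular)
      (auto simp: m.I_prime dest: m.I_prime)
qed

text \<open>
  If all values of the form were in \<open>m\<close>, then all values of the localized form, and in particular the
  entries of its matrix, would be fractions with numerator in \<open>m\<close>. Such fractions form an ideal \<open>J\<close> of
  the local ring, which contains the Pfaffian, since every term of the Pfaffian has at least one
  entry as a factor. But \<open>J\<close> does not contain 1.
\<close>
lemma ex_form_value_notin_prime:
  fixes R (structure) and P (structure) and n :: nat
  assumes cring: "cring R" and P: "module R P" and B: "bilinear_form R P B" and m: "primeideal m R"
    and b: "b \<in> {..<2 * n} \<rightarrow> carrier (module_at R m P)"
    and alt: "alternating_matrix (ring_at R m) (2 * n) \<phi>"
    and \<phi>: "form_matrix (ring_at R m) (module_at R m P) (form_at R m B) (2 * n) b \<phi>"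
    and pf: "pfaffian (ring_at R m) n \<phi> = \<one>\<^bsub>ring_at R m\<^esub>" and n: "n \<ge> 1"
  shows "\<exists>x\<in>carrier P. \<exists>y\<in>carrier P. B x y \<notin> m"
proof (rule ccontr)
  assume "\<not> ?thesis"
  then have all: "\<And>x y. x \<in> carrier P \<Longrightarrow> y \<in> carrier P \<Longrightarrow> B x y \<in> m" by blast
  interpret R: cring R by fact
  interpret m: primeideal m R by fact
  define S where "S = carrier R - m"
  interpret RL: ring_localization R S unfolding S_def by (rule R.primeideal_localization[OF m])
  interpret PL: localization R P S
    by (intro localization.intro localization_axioms.intro P) (simp_all add: RL.S_subset)
  define L where "L = loc_ring R S"
  have Lat: "ring_at R m = L" by (simp add: ring_at_def L_def S_def)
  have Pat: "module_at R m P = loc_module R S P" by (simp add: module_at_def S_def)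
  interpret L: cring L unfolding L_def by (rule RL.loc_cring)
  interpret LP: abelian_group "loc_module R S P" by (rule PL.loc_abelian_group)
  define J where "J = {RL.frac a s | a s. a \<in> m \<and> s \<in> S}"
  have J_carrier: "J \<subseteq> carrier L" by (auto simp: J_def L_def)
  have J_zero: "\<zero>\<^bsub>L\<^esub> \<in> J" unfolding J_def L_def RL.loc_ring_simps
    using additive_subgroup.zero_closed[OF m.additive_subgroup_axioms] RL.S_one by blast
  have J_add: "x \<oplus>\<^bsub>L\<^esub> y \<in> J" if xy: "x \<in> J" "y \<in> J" for x y
  proof -
    obtain a s c t where as: "a \<in> m" "s \<in> S" "c \<in> m" "t \<in> S" "x = RL.frac a s" "y = RL.frac c t"
      using xy unfolding J_def by blast
    then have "x \<oplus>\<^bsub>L\<^esub> y = RL.frac (t \<otimes> a \<oplus> s \<otimes> c) (s \<otimes> t)" by (simp add: L_def RL.loc_ring_add)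
    moreover have "t \<otimes> a \<oplus> s \<otimes> c \<in> m" using as by (simp add: m.I_l_closed)
    ultimately show ?thesis using RL.S_mult[OF as(2,4)] unfolding J_def by blast
  qed
  have J_mult: "y \<otimes>\<^bsub>L\<^esub> x \<in> J" "x \<otimes>\<^bsub>L\<^esub> y \<in> J" if xy: "x \<in> J" "y \<in> carrier L" for x y
  proof -
    obtain a s c t where as: "a \<in> m" "s \<in> S" "c \<in> carrier R" "t \<in> S" "x = RL.frac a s" "y = RL.frac c t"
      using xy unfolding J_def L_def RL.loc_ring_simps by blast
    then have "y \<otimes>\<^bsub>L\<^esub> x = RL.frac (c \<otimes> a) (t \<otimes> s)" by (simp add: L_def RL.loc_ring_mult)
    moreover have "c \<otimes> a \<in> m" using as by (simp add: m.I_l_closed)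
    ultimately show "y \<otimes>\<^bsub>L\<^esub> x \<in> J" using RL.S_mult[OF as(4,2)] unfolding J_def by blast
    then show "x \<otimes>\<^bsub>L\<^esub> y \<in> J" using xy J_carrier L.m_comm[of x y] by auto
  qed
  have J_one: "\<one>\<^bsub>L\<^esub> \<notin> J"
  proof
    assume "\<one>\<^bsub>L\<^esub> \<in> J"
    then obtain a s where as: "a \<in> m" "s \<in> S" and "RL.frac \<one> \<one> = RL.frac a s"
      unfolding J_def L_def RL.loc_ring_simps by blast
    then obtain u where u: "u \<in> S" and eq: "u \<otimes> s \<otimes> \<one> = u \<otimes> \<one> \<otimes> a"
      using RL.frac_eq_iff[of \<one> \<one> a s] by auto
    then have "u \<otimes> s \<in> m" using as by (simp add: m.I_l_closed)
    then show False using RL.S_mult[OF u as(2)] by (simp add: S_def)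
  qed
  have form_J: "form_at R m B U V \<in> J"
    if UV: "U \<in> carrier (loc_module R S P)" "V \<in> carrier (loc_module R S P)" for U V
  proof -
    have B_carrier: "B x y \<in> carrier R" if "x \<in> carrier P" "y \<in> carrier P" for x y
      using all[OF that] m.Icarr by blast
    have B_smult: "B (r \<odot>\<^bsub>P\<^esub> x) (q \<odot>\<^bsub>P\<^esub> y) = r \<otimes> q \<otimes> B x y"
      if "r \<in> carrier R" "q \<in> carrier R" "x \<in> carrier P" "y \<in> carrier P" for r q x y
      using B that unfolding bilinear_form_def module_hom_def regular_module_def
      by (simp add: R.m_ac B_carrier)
    obtain x s y t where [simp]: "x \<in> carrier P" "s \<in> S" "y \<in> carrier P" "t \<in> S"
      and U: "U = PL.frac x s" and V: "V = PL.frac y t"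
      using UV unfolding PL.carrier_loc_module by blast
    have "(\<Union>(x, s)\<in>PL.frac x s. \<Union>(y, t)\<in>PL.frac y t. RL.frac (B x y) (s \<otimes> t)) = RL.frac (B x y) (s \<otimes> t)"
    proof (rule UN_UN_const)
      fix x' s' y' t' assume xs: "(x', s') \<in> PL.frac x s" and yt: "(y', t') \<in> PL.frac y t"
      obtain u v where uv[simp]: "x' \<in> carrier P" "s' \<in> S" "y' \<in> carrier P" "t' \<in> S" "u \<in> S" "v \<in> S"
        and 1: "(u \<otimes> s') \<odot>\<^bsub>P\<^esub> x = (u \<otimes> s) \<odot>\<^bsub>P\<^esub> x'" and 2: "(v \<otimes> t') \<odot>\<^bsub>P\<^esub> y = (v \<otimes> t) \<odot>\<^bsub>P\<^esub> y'"
        using PL.mem_fracD[OF xs] PL.mem_fracD[OF yt] by auto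
      have "u \<otimes> v \<otimes> (s \<otimes> t) \<otimes> B x' y' = B ((u \<otimes> s) \<odot>\<^bsub>P\<^esub> x') ((v \<otimes> t) \<odot>\<^bsub>P\<^esub> y')"
        by (simp add: B_smult B_carrier R.m_ac)
      also have "\<dots> = u \<otimes> v \<otimes> (s' \<otimes> t') \<otimes> B x y"
        unfolding 1[symmetric] 2[symmetric] by (simp add: B_smult B_carrier R.m_ac)
      finally show "RL.frac (B x' y') (s' \<otimes> t') = RL.frac (B x y) (s \<otimes> t)"
        by (subst RL.frac_eq_iff) (auto intro!: bexI[of _ "u \<otimes> v"] simp: B_carrier)
    qed (simp_all add: PL.frac_nonempty)
    then have "form_at R m B U V = RL.frac (B x y) (s \<otimes> t)" by (simp add: form_at_def U V S_def)
    moreover have "B x y \<in> m" "s \<otimes> t \<in> S" by (simp_all add: all)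
    ultimately show ?thesis unfolding J_def by blast
  qed
  have \<phi>J: "\<phi> k l \<in> J" if kl: "k < 2 * n" "l < 2 * n" for k l
  proof -
    have \<phi>L: "\<phi> i j \<in> carrier L" if "i < 2 * n" "j < 2 * n" for i j
      using alt that unfolding alternating_matrix_def Lat by blast
    \<comment> \<open>the coordinates of the basis vectors; they isolate a single entry of the matrix\<close>
    define c where "c = (\<lambda>k i :: nat. if i = k then \<one>\<^bsub>L\<^esub> else \<zero>\<^bsub>L\<^esub>)"
    have c: "c k i \<in> carrier L" for k i by (simp add: c_def)
    have smult: "a \<odot>\<^bsub>loc_module R S P\<^esub> v \<in> carrier (loc_module R S P)"
      if "a \<in> carrier L" "v \<in> carrier (loc_module R S P)" for a v
      using PL.loc_smult_closed[of a v] that RL.carrier_loc_module by (simp add: L_def RL.loc_ring_simps)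
    have lin: "lin_comb (loc_module R S P) (2 * n) b (c k) \<in> carrier (loc_module R S P)" for k
      unfolding lin_comb_def using b c by (intro LP.finsum_closed) (auto simp: Pat intro!: smult)
    have "form_at R m B (lin_comb (loc_module R S P) (2 * n) b (c k)) (lin_comb (loc_module R S P) (2 * n) b (c l))
      = (\<Oplus>\<^bsub>L\<^esub>i\<in>{..<2 * n}. \<Oplus>\<^bsub>L\<^esub>j\<in>{..<2 * n}. c k i \<otimes>\<^bsub>L\<^esub> \<phi> i j \<otimes>\<^bsub>L\<^esub> c l j)"
      using \<phi> c unfolding form_matrix_def Lat Pat by (auto simp: Pi_def)
    also have "\<dots> = (\<Oplus>\<^bsub>L\<^esub>i\<in>{..<2 * n}. if k = i then \<phi> i l else \<zero>\<^bsub>L\<^esub>)"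
    proof (rule L.finsum_cong')
      fix i assume i: "i \<in> {..<2 * n}"
      have "(\<Oplus>\<^bsub>L\<^esub>j\<in>{..<2 * n}. c k i \<otimes>\<^bsub>L\<^esub> \<phi> i j \<otimes>\<^bsub>L\<^esub> c l j)
        = (\<Oplus>\<^bsub>L\<^esub>j\<in>{..<2 * n}. if l = j then c k i \<otimes>\<^bsub>L\<^esub> \<phi> i j else \<zero>\<^bsub>L\<^esub>)"
        by (rule L.finsum_cong') (use i \<phi>L c in \<open>auto simp: c_def\<close>)
      also have "\<dots> = c k i \<otimes>\<^bsub>L\<^esub> \<phi> i l"
        by (rule L.finsum_singleton) (use i \<phi>L c kl in auto)
      also have "\<dots> = (if k = i then \<phi> i l else \<zero>\<^bsub>L\<^esub>)" using \<phi>L i kl by (simp add: c_def)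
      finally show "(\<Oplus>\<^bsub>L\<^esub>j\<in>{..<2 * n}. c k i \<otimes>\<^bsub>L\<^esub> \<phi> i j \<otimes>\<^bsub>L\<^esub> c l j) = (if k = i then \<phi> i l else \<zero>\<^bsub>L\<^esub>)" .
    qed (use \<phi>L kl in auto)
    also have "\<dots> = \<phi> k l" by (rule L.finsum_singleton) (use \<phi>L kl in auto)
    finally show ?thesis using form_J[OF lin lin, of k l] by simp
  qed
  have sum_J: "(\<Oplus>\<^bsub>L\<^esub>i\<in>A. g i) \<in> J" if "\<And>i. i \<in> A \<Longrightarrow> g i \<in> J" for A :: "(nat \<Rightarrow> nat) set" and g
  proof (cases "finite A")
    case True
    then show ?thesis using that
    proof (induction A)
      case (insert x A)
      then have "(\<Oplus>\<^bsub>L\<^esub>i\<in>insert x A. g i) = g x \<oplus>\<^bsub>L\<^esub> (\<Oplus>\<^bsub>L\<^esub>i\<in>A. g i)"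
        using J_carrier by (intro L.finsum_insert) auto
      then show ?case using insert by (simp add: J_add)
    qed (simp add: J_zero)
  qed (simp add: L.finsum_infinite J_zero)
  have "pfaffian L n \<phi> \<in> J"
    unfolding pfaffian_def
  proof (intro sum_J J_mult(1))
    fix \<pi> assume "\<pi> \<in> perfect_matchings n"
    then have perm: "\<pi> permutes {..<2 * n}" by (simp add: perfect_matchings_def)
    have entry: "\<phi> (\<pi> (2 * i)) (\<pi> (2 * i + 1)) \<in> J" if "i < n" for i
      using permutes_in_image[OF perm, of "2 * i"] permutes_in_image[OF perm, of "2 * i + 1"] that
      by (intro \<phi>J) auto
    obtain n' where n': "n = Suc n'" using n by (cases n) auto
    have "(\<Otimes>\<^bsub>L\<^esub>i\<in>{..<n}. \<phi> (\<pi> (2 * i)) (\<pi> (2 * i + 1)))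
      = \<phi> (\<pi> (2 * n')) (\<pi> (2 * n' + 1)) \<otimes>\<^bsub>L\<^esub> (\<Otimes>\<^bsub>L\<^esub>i\<in>{..<n'}. \<phi> (\<pi> (2 * i)) (\<pi> (2 * i + 1)))"
      unfolding n' lessThan_Suc using entry n' J_carrier by (intro L.finprod_insert) auto
    moreover have "(\<Otimes>\<^bsub>L\<^esub>i\<in>{..<n'}. \<phi> (\<pi> (2 * i)) (\<pi> (2 * i + 1))) \<in> carrier L"
      using entry n' J_carrier by (intro L.finprod_closed) auto
    ultimately show "(\<Otimes>\<^bsub>L\<^esub>i\<in>{..<n}. \<phi> (\<pi> (2 * i)) (\<pi> (2 * i + 1))) \<in> J"
      using J_mult(2)[OF entry[of n']] n' by simp
  qed simp
  then show False using pf J_one by (simp add: Lat)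
qed

section \<open>The module \<open>R\<^sup>2 \<oplus> P\<close>\<close>

locale hyperbolic_extension = alternating_space
begin

abbreviation Q where "Q \<equiv> hyp_module R M"
abbreviation BQ where "BQ \<equiv> hyp_form R B"

lemma carrier_Q: "carrier Q = carrier R \<times> carrier R \<times> carrier M"
  by (simp add: hyp_module_def direct_sum_def regular_module_def)

lemma Q_simps [simp]:
  "(a, b, p) \<oplus>\<^bsub>Q\<^esub> (a', b', p') = (a \<oplus> a', b \<oplus> b', p \<oplus>\<^bsub>M\<^esub> p')"
  "\<zero>\<^bsub>Q\<^esub> = (\<zero>, \<zero>, \<zero>\<^bsub>M\<^esub>)"
  "c \<odot>\<^bsub>Q\<^esub> (a, b, p) = (c \<otimes> a, c \<otimes> b, c \<odot>\<^bsub>M\<^esub> p)"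
  "BQ (a, b, p) (a', b', p') = (a \<otimes> b' \<ominus> b \<otimes> a') \<oplus> B p p'"
  by (simp_all add: hyp_module_def direct_sum_def regular_module_def hyp_form_def)

lemma module_Q: "module R Q"
proof (rule moduleI)
  show "abelian_group Q"
  proof (rule abelian_groupI)
    show "\<exists>y\<in>carrier Q. y \<oplus>\<^bsub>Q\<^esub> x = \<zero>\<^bsub>Q\<^esub>" if "x \<in> carrier Q" for x
    proof -
      obtain a b p where "x = (a, b, p)" by (rule prod_cases3)
      then show ?thesis using that
        by (intro bexI[of _ "(\<ominus> a, \<ominus> b, \<ominus>\<^bsub>M\<^esub> p)"]) (simp_all add: carrier_Q R.l_neg M.l_neg)
    qed
  qed (auto simp: carrier_Q R.a_ac M.a_ac)
qed (auto simp: carrier_Q R.is_cring R.l_distr R.r_distr R.m_assoc smult_l_distr smult_r_distr smult_assoc1)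

lemma alternating_Q: "alternating_form R Q BQ"
proof -
  interpret QM: module R Q by (rule module_Q)
  have lin: "(\<lambda>y\<in>carrier Q. BQ x y) \<in> module_hom R Q (regular_module R)" if "x \<in> carrier Q" for x
  proof -
    have "BQ x (y \<oplus>\<^bsub>Q\<^esub> z) = BQ x y \<oplus> BQ x z" if "y \<in> carrier Q" "z \<in> carrier Q" for y z
      using that \<open>x \<in> carrier Q\<close>
      by (auto simp: carrier_Q form_simps R.minus_eq R.r_distr R.minus_add R.a_ac)
    moreover have "BQ x (c \<odot>\<^bsub>Q\<^esub> y) = c \<otimes> BQ x y" if "y \<in> carrier Q" "c \<in> carrier R" for y c
      using that \<open>x \<in> carrier Q\<close>
      by (auto simp: carrier_Q form_simps R.minus_eq R.r_distr R.r_minus R.m_ac)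
    moreover have "BQ x y \<in> carrier R" if "y \<in> carrier Q" for y
      using that \<open>x \<in> carrier Q\<close> by (auto simp: carrier_Q)
    ultimately show ?thesis by (simp add: module_hom_def regular_module_def)
  qed
  have skew: "BQ x y = \<ominus> \<one> \<otimes> BQ y x" if "x \<in> carrier Q" "y \<in> carrier Q" for x y
  proof -
    obtain a b p where x: "x = (a, b, p)" by (rule prod_cases3)
    obtain c d q where y: "y = (c, d, q)" by (rule prod_cases3)
    have [simp]: "a \<in> carrier R" "b \<in> carrier R" "c \<in> carrier R" "d \<in> carrier R" "p \<in> carrier M" "q \<in> carrier M"
      using that by (simp_all add: x y carrier_Q)
    show ?thesis using form_skew[of q p]
      by (simp add: x y R.minus_eq R.l_minus R.minus_add R.m_ac R.a_ac)
  qed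
  have lin': "(\<lambda>x\<in>carrier Q. BQ x y) \<in> module_hom R Q (regular_module R)" if y: "y \<in> carrier Q" for y
  proof -
    have BQ: "BQ y x \<in> carrier R" if "x \<in> carrier Q" for x using that y by (auto simp: carrier_Q)
    have "BQ (x \<oplus>\<^bsub>Q\<^esub> z) y = BQ x y \<oplus> BQ z y" if xz: "x \<in> carrier Q" "z \<in> carrier Q" for x z
    proof -
      have "BQ y (x \<oplus>\<^bsub>Q\<^esub> z) = BQ y x \<oplus> BQ y z"
        using lin[OF y] xz by (simp add: module_hom_def regular_module_def)
      then show ?thesis using xz y by (simp add: skew[of _ y] R.r_distr BQ)
    qed
    moreover have "BQ (c \<odot>\<^bsub>Q\<^esub> x) y = c \<otimes> BQ x y" if xc: "x \<in> carrier Q" "c \<in> carrier R" for x c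
    proof -
      have "BQ y (c \<odot>\<^bsub>Q\<^esub> x) = c \<otimes> BQ y x"
        using lin[OF y] xc by (simp add: module_hom_def regular_module_def)
      then show ?thesis using xc y by (simp add: skew[of _ y] R.m_lcomm BQ)
    qed
    moreover have "BQ x y \<in> carrier R" if "x \<in> carrier Q" for x
      using that y by (auto simp: carrier_Q)
    ultimately show ?thesis by (simp add: module_hom_def regular_module_def)
  qed
  have "BQ x x = \<zero>" if "x \<in> carrier Q" for x
    using that by (auto simp: carrier_Q R.minus_eq R.m_comm R.r_neg)
  then show ?thesis by (simp add: alternating_form_def bilinear_form_def lin lin')
qed

sublocale Q: hyperbolic_pair R Q BQ h "(\<one>, \<zero>, \<zero>\<^bsub>M\<^esub>)" "(\<zero>, \<one>, \<zero>\<^bsub>M\<^esub>)"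
  by (intro hyperbolic_pair.intro alternating_space.intro alternating_space_axioms.intro
      hyperbolic_pair_axioms.intro module_Q alternating_Q half_closed half)
    (simp_all add: carrier_Q R.minus_eq)

abbreviation e where "e \<equiv> (\<one>, \<zero>, \<zero>\<^bsub>M\<^esub>)"
abbreviation f where "f \<equiv> (\<zero>, \<one>, \<zero>\<^bsub>M\<^esub>)"

lemma core_Q: "Q.core = {(\<zero>, \<zero>, p) | p. p \<in> carrier M}"
  by (auto simp: Q.core_def carrier_Q R.minus_eq)

lemma perp_e: "Q.perp e = {(a, \<zero>, p) | a p. a \<in> carrier R \<and> p \<in> carrier M}"
  by (auto simp: Q.perp_def carrier_Q R.minus_eq)

lemma perp_f: "Q.perp f = {(\<zero>, b, p) | b p. b \<in> carrier R \<and> p \<in> carrier M}"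
  by (auto simp: Q.perp_def carrier_Q R.minus_eq)

lemma half_mult: "x \<in> carrier R \<Longrightarrow> h \<otimes> x \<oplus> h \<otimes> x = x"
  using R.l_distr[of h h x] half by simp

text \<open>
  The component \<open>h \<alpha>\<close> of the second argument along \<open>f\<close> counts twice in a transvection along \<open>f\<close>, once
  through each of the two terms.
\<close>
lemma transv_rho_eq:
  assumes [simp]: "q \<in> carrier M" "\<alpha> \<in> carrier R"
  shows "transv_rho R M B q \<alpha> = Q.transvec f (\<zero>, h \<otimes> \<alpha>, q)"
  unfolding transv_rho_def Q.transvec_def
proof (rule restrict_ext, clarify)
  fix a b p assume "(a, b, p) \<in> carrier Q"
  then have [simp]: "a \<in> carrier R" "b \<in> carrier R" "p \<in> carrier M" by (simp_all add: carrier_Q)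
  have qp: "B q p = \<ominus> B p q" by (rule form_skew) simp_all
  have "\<ominus> (\<alpha> \<otimes> a) = \<ominus> (h \<otimes> (\<alpha> \<otimes> a)) \<oplus> \<ominus> (h \<otimes> (\<alpha> \<otimes> a))"
    by (subst half_mult[of "\<alpha> \<otimes> a", symmetric]) (simp_all add: R.minus_add)
  then show "(a, b \<ominus> B p q \<ominus> \<alpha> \<otimes> a, p \<ominus>\<^bsub>M\<^esub> a \<odot>\<^bsub>M\<^esub> q) = (a, b, p) \<oplus>\<^bsub>Q\<^esub>
    (BQ f (a, b, p) \<odot>\<^bsub>Q\<^esub> (\<zero>, h \<otimes> \<alpha>, q) \<oplus>\<^bsub>Q\<^esub> BQ (\<zero>, h \<otimes> \<alpha>, q) (a, b, p) \<odot>\<^bsub>Q\<^esub> f)"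
    by (simp add: R.minus_eq M.minus_eq qp smult_l_minus R.l_minus R.r_minus R.a_ac R.m_ac)
qed

lemma transv_mu_eq:
  assumes [simp]: "q \<in> carrier M" "\<beta> \<in> carrier R"
  shows "transv_mu R M B q \<beta> = Q.transvec e (h \<otimes> \<beta>, \<zero>, \<ominus>\<^bsub>M\<^esub> q)"
  unfolding transv_mu_def Q.transvec_def
proof (rule restrict_ext, clarify)
  fix a b p assume "(a, b, p) \<in> carrier Q"
  then have [simp]: "a \<in> carrier R" "b \<in> carrier R" "p \<in> carrier M" by (simp_all add: carrier_Q)
  have m: "\<ominus>\<^bsub>M\<^esub> q = (\<ominus> \<one>) \<odot>\<^bsub>M\<^esub> q" by (simp add: smult_l_minus)
  have qp: "B (\<ominus>\<^bsub>M\<^esub> q) p = B p q"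
    using form_skew[of p q] by (simp add: m form_simps R.l_minus)
  have "\<beta> \<otimes> b = h \<otimes> (\<beta> \<otimes> b) \<oplus> h \<otimes> (\<beta> \<otimes> b)"
    by (simp add: half_mult)
  then show "(a \<oplus> B p q \<oplus> \<beta> \<otimes> b, b, p \<ominus>\<^bsub>M\<^esub> b \<odot>\<^bsub>M\<^esub> q) = (a, b, p) \<oplus>\<^bsub>Q\<^esub>
    (BQ e (a, b, p) \<odot>\<^bsub>Q\<^esub> (h \<otimes> \<beta>, \<zero>, \<ominus>\<^bsub>M\<^esub> q) \<oplus>\<^bsub>Q\<^esub> BQ (h \<otimes> \<beta>, \<zero>, \<ominus>\<^bsub>M\<^esub> q) (a, b, p) \<odot>\<^bsub>Q\<^esub> e)"
    by (simp add: R.minus_eq M.minus_eq qp smult_r_minus R.a_ac R.m_ac)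
qed

lemma half_half: "b \<in> carrier R \<Longrightarrow> h \<otimes> (b \<oplus> b) = b"
  by (simp add: R.r_distr half_mult)

lemma ETrans_eq: "ETrans R M B = Q.elementary"
proof -
  have "{transv_rho R M B q \<alpha> | q \<alpha>. q \<in> carrier M \<and> \<alpha> \<in> carrier R} = Q.transvec f ` Q.perp f"
  proof (intro subset_antisym subsetI)
    fix x assume "x \<in> Q.transvec f ` Q.perp f"
    then obtain b p where b: "b \<in> carrier R" and p: "p \<in> carrier M" and x: "x = Q.transvec f (\<zero>, b, p)"
      unfolding perp_f by blast
    have "x = transv_rho R M B p (b \<oplus> b)" using b p by (simp add: x transv_rho_eq half_half)
    with b p show "x \<in> {transv_rho R M B q \<alpha> | q \<alpha>. q \<in> carrier M \<and> \<alpha> \<in> carrier R}" by blast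
  qed (auto simp: transv_rho_eq perp_f)
  moreover have "{transv_mu R M B q \<beta> | q \<beta>. q \<in> carrier M \<and> \<beta> \<in> carrier R} = Q.transvec e ` Q.perp e"
  proof (intro subset_antisym subsetI)
    fix x assume "x \<in> Q.transvec e ` Q.perp e"
    then obtain a p where a: "a \<in> carrier R" and p: "p \<in> carrier M" and x: "x = Q.transvec e (a, \<zero>, p)"
      unfolding perp_e by blast
    have "x = transv_mu R M B (\<ominus>\<^bsub>M\<^esub> p) (a \<oplus> a)" using a p by (simp add: x transv_mu_eq half_half)
    with a p show "x \<in> {transv_mu R M B q \<beta> | q \<beta>. q \<in> carrier M \<and> \<beta> \<in> carrier R}" by blast
  qed (auto simp: transv_mu_eq perp_e)
  ultimately show ?thesis unfolding ETrans_def Q.elementary_def by (simp add: Un_commute)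
qed

lemma ideal_mult_module_least:
  assumes "submodule H R M" "\<And>c x. c \<in> I \<Longrightarrow> x \<in> carrier M \<Longrightarrow> c \<odot>\<^bsub>M\<^esub> x \<in> H"
  shows "ideal_mult_module R I M \<subseteq> H"
  using assms unfolding ideal_mult_module_def module_span_def by blast

lemma smult_mem_ideal_mult_module:
  "c \<in> I \<Longrightarrow> x \<in> carrier M \<Longrightarrow> c \<odot>\<^bsub>M\<^esub> x \<in> ideal_mult_module R I M"
  unfolding ideal_mult_module_def module_span_def by blast

lemma ETrans_rel_normal:
  assumes I: "ideal I R"
    and unit: "\<And>m. maximalideal m R \<Longrightarrow> \<exists>x\<in>carrier M. \<exists>y\<in>carrier M. B x y \<notin> m"
  shows "ETrans_rel R M B I \<lhd> Sp_hyp R M B"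
proof -
  let ?IM = "ideal_mult_module R I M"
  let ?T = "{transv_rho R M B q \<alpha> | q \<alpha>. q \<in> ?IM \<and> \<alpha> \<in> I} \<union> {transv_mu R M B q \<beta> | q \<beta>. q \<in> ?IM \<and> \<beta> \<in> I}"
  have IR: "c \<in> carrier R" if "c \<in> I" for c using ideal.Icarr[OF I that] .
  have zero: "\<zero> \<in> I" by (rule additive_subgroup.zero_closed[OF ideal.axioms(1)[OF I]])
  have IM: "q \<in> carrier M" if "q \<in> ?IM" for q
    using ideal_mult_module_least[OF carrier_is_submodule, of I] that IR by auto
  \<comment> \<open>the span of the products \<open>c p\<close> in \<open>P\<close> is carried over to \<open>Q\<close> by pulling submodules back\<close>
  have core_mem: "(\<zero>, \<zero>, q) \<in> H"
    if q: "q \<in> ?IM" and H: "submodule H R Q"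
      and cz: "\<And>c z. c \<in> I \<Longrightarrow> z \<in> Q.core \<Longrightarrow> c \<odot>\<^bsub>Q\<^esub> z \<in> H" for q H
  proof -
    have "submodule {p \<in> carrier M. (\<zero>, \<zero>, p) \<in> H} R M"
    proof (rule submoduleI')
      show "\<zero>\<^bsub>M\<^esub> \<in> {p \<in> carrier M. (\<zero>, \<zero>, p) \<in> H}" using Q.submodule_zero[OF H] by simp
      show "x \<oplus>\<^bsub>M\<^esub> y \<in> {p \<in> carrier M. (\<zero>, \<zero>, p) \<in> H}"
        if "x \<in> {p \<in> carrier M. (\<zero>, \<zero>, p) \<in> H}" "y \<in> {p \<in> carrier M. (\<zero>, \<zero>, p) \<in> H}" for x y
        using that Q.submoduleE(5)[OF H, of "(\<zero>, \<zero>, x)" "(\<zero>, \<zero>, y)"] by simp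
      show "a \<odot>\<^bsub>M\<^esub> x \<in> {p \<in> carrier M. (\<zero>, \<zero>, p) \<in> H}"
        if "a \<in> carrier R" "x \<in> {p \<in> carrier M. (\<zero>, \<zero>, p) \<in> H}" for a x
        using that Q.submoduleE(4)[OF H, of a "(\<zero>, \<zero>, x)"] by simp
    qed auto
    moreover have "c \<odot>\<^bsub>M\<^esub> x \<in> {p \<in> carrier M. (\<zero>, \<zero>, p) \<in> H}" if "c \<in> I" "x \<in> carrier M" for c x
      using cz[OF that(1), of "(\<zero>, \<zero>, x)"] that IR by (simp add: core_Q)
    ultimately show ?thesis using ideal_mult_module_least[of _ I] q by blast
  qed
  have "normal_closure (Sp_hyp R M B\<lparr>carrier := Q.elementary\<rparr>) (generate (Sp_hyp R M B) ?T) \<lhd> Sp_hyp R M B"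
  proof (rule Q.relative_elementary_normal[OF _ I])
    fix m assume "maximalideal m R"
    then obtain x y where xy: "x \<in> carrier M" "y \<in> carrier M" "B x y \<notin> m" using unit by blast
    show "\<exists>x\<in>Q.core. \<exists>y\<in>Q.core. BQ x y \<notin> m"
      by (intro bexI[of _ "(\<zero>, \<zero>, x)"] bexI[of _ "(\<zero>, \<zero>, y)"]) (use xy in \<open>simp_all add: core_Q R.minus_eq\<close>)
  next
    fix c d q assume c: "c \<in> I" and d: "d \<in> {e, f}" and "q \<in> Q.core"
    then obtain p where p: "p \<in> carrier M" and q: "q = (\<zero>, \<zero>, p)" by (auto simp: core_Q)
    note cR[simp] = IR[OF c]
    consider "d = e" | "d = f" using d by blast
    then show "Q.transvec d (c \<odot>\<^bsub>Q\<^esub> q) \<in> ?T"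
    proof cases
      case 1
      have "Q.transvec d (c \<odot>\<^bsub>Q\<^esub> q) = transv_mu R M B (c \<odot>\<^bsub>M\<^esub> (\<ominus>\<^bsub>M\<^esub> p)) \<zero>"
        using p by (simp add: 1 q transv_mu_eq smult_r_minus)
      then show ?thesis using smult_mem_ideal_mult_module[OF c, of "\<ominus>\<^bsub>M\<^esub> p"] p zero by blast
    next
      case 2
      have "Q.transvec d (c \<odot>\<^bsub>Q\<^esub> q) = transv_rho R M B (c \<odot>\<^bsub>M\<^esub> p) \<zero>"
        using p by (simp add: 2 q transv_rho_eq)
      then show ?thesis using smult_mem_ideal_mult_module[OF c p] zero by blast
    qed
  next
    fix x assume "x \<in> ?T"
    then consider (rho) q \<alpha> where "q \<in> ?IM" "\<alpha> \<in> I" "x = transv_rho R M B q \<alpha>"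
      | (mu) q \<beta> where "q \<in> ?IM" "\<beta> \<in> I" "x = transv_mu R M B q \<beta>" by blast
    then show "\<exists>d\<in>{e, f}. \<exists>w\<in>Q.perp d. x = Q.transvec d w \<and>
      (\<forall>H. submodule H R Q \<longrightarrow> (\<forall>c\<in>I. \<forall>z\<in>Q.perp d. c \<odot>\<^bsub>Q\<^esub> z \<in> H) \<longrightarrow> w \<in> H)"
    proof cases
      case rho
      let ?w = "(\<zero>, h \<otimes> \<alpha>, q)"
      note [simp] = IR[OF rho(2)] IM[OF rho(1)]
      have "?w \<in> H" if H: "submodule H R Q" and cz: "\<forall>c\<in>I. \<forall>z\<in>Q.perp f. c \<odot>\<^bsub>Q\<^esub> z \<in> H" for H
      proof -
        have "\<alpha> \<odot>\<^bsub>Q\<^esub> (\<zero>, h, \<zero>\<^bsub>M\<^esub>) \<in> H" 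
          by (rule cz[rule_format, OF rho(2)]) (simp add: perp_f)
        moreover have "(\<zero>, \<zero>, q) \<in> H"
          by (rule core_mem[OF rho(1) H]) (rule cz[rule_format], auto simp: perp_f core_Q)
        ultimately have "\<alpha> \<odot>\<^bsub>Q\<^esub> (\<zero>, h, \<zero>\<^bsub>M\<^esub>) \<oplus>\<^bsub>Q\<^esub> (\<zero>, \<zero>, q) \<in> H" by (rule Q.submoduleE(5)[OF H])
        then show ?thesis by (simp add: R.m_comm)
      qed
      moreover have "?w \<in> Q.perp f" by (simp add: perp_f)
      moreover have "x = Q.transvec f ?w" by (simp add: rho(3) transv_rho_eq)
      ultimately show ?thesis by blast
    next
      case mu
      let ?w = "(h \<otimes> \<beta>, \<zero>, \<ominus>\<^bsub>M\<^esub> q)"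
      note [simp] = IR[OF mu(2)] IM[OF mu(1)]
      have "?w \<in> H" if H: "submodule H R Q" and cz: "\<forall>c\<in>I. \<forall>z\<in>Q.perp e. c \<odot>\<^bsub>Q\<^esub> z \<in> H" for H
      proof -
        have "\<beta> \<odot>\<^bsub>Q\<^esub> (h, \<zero>, \<zero>\<^bsub>M\<^esub>) \<in> H" 
          by (rule cz[rule_format, OF mu(2)]) (simp add: perp_e)
        moreover have "(\<zero>, \<zero>, q) \<in> H"
          by (rule core_mem[OF mu(1) H]) (rule cz[rule_format], auto simp: perp_e core_Q)
        then have "(\<ominus> \<one>) \<odot>\<^bsub>Q\<^esub> (\<zero>, \<zero>, q) \<in> H" by (intro Q.submoduleE(4)[OF H]) simp_all
        ultimately have "\<beta> \<odot>\<^bsub>Q\<^esub> (h, \<zero>, \<zero>\<^bsub>M\<^esub>) \<oplus>\<^bsub>Q\<^esub> (\<ominus> \<one>) \<odot>\<^bsub>Q\<^esub> (\<zero>, \<zero>, q) \<in> H"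
          by (rule Q.submoduleE(5)[OF H])
        then show ?thesis by (simp add: R.m_comm smult_l_minus)
      qed
      moreover have "?w \<in> Q.perp e" by (simp add: perp_e)
      moreover have "x = Q.transvec e ?w" by (simp add: mu(3) transv_mu_eq)
      ultimately show ?thesis by blast
    qed
  qed
  then show ?thesis by (simp add: ETrans_rel_def ETrans_ideal_def ETrans_eq)
qed

end

theorem theorem4p19:
  fixes R :: "('a, 'm) ring_scheme" and P :: "('a, 'b, 'k) module_scheme"
    and B :: "'b \<Rightarrow> 'b \<Rightarrow> 'a" and I :: "'a set" and n :: nat
  assumes "cring R"
    and "carrier R = (\<lambda>x. x \<oplus>\<^bsub>R\<^esub> x) ` carrier R"
    and "ideal I R"
    and "symplectic_module R P B"
    and "has_rank R P (2 * n)"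
    and "n \<ge> 1"
    and "\<And>\<mm>. maximalideal \<mm> R \<Longrightarrow>
      \<exists>b \<phi>. module_basis (ring_at R \<mm>) (module_at R \<mm> P) (2 * n) b \<and>
        alternating_matrix (ring_at R \<mm>) (2 * n) \<phi> \<and>
        form_matrix (ring_at R \<mm>) (module_at R \<mm> P) (form_at R \<mm> B) (2 * n) b \<phi> \<and>
        pfaffian (ring_at R \<mm>) n \<phi> = \<one>\<^bsub>ring_at R \<mm>\<^esub> \<and>
        matrix_cong (ring_at R \<mm>) (ideal_at R \<mm> I) (2 * n) \<phi> (std_alt_matrix (ring_at R \<mm>))"
  shows "ETrans_rel R P B I \<lhd> Sp_hyp R P B"
proof -
  interpret R: cring R by fact
  have P: "module R P" and alt: "alternating_form R P B"
    using \<open>symplectic_module R P B\<close> by (simp_all add: symplectic_module_def)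
  have "\<one>\<^bsub>R\<^esub> \<in> (\<lambda>x. x \<oplus>\<^bsub>R\<^esub> x) ` carrier R" using assms(2) R.one_closed by blast
  then obtain h where h: "h \<in> carrier R" "h \<oplus>\<^bsub>R\<^esub> h = \<one>\<^bsub>R\<^esub>" by auto
  interpret hyperbolic_extension R P B h
    by (intro hyperbolic_extension.intro alternating_space.intro alternating_space_axioms.intro P alt h)
  show ?thesis
  proof (rule ETrans_rel_normal[OF \<open>ideal I R\<close>])
    fix m assume m: "maximalideal m R"
    from assms(7)[OF m] obtain b \<phi> where "module_basis (ring_at R m) (module_at R m P) (2 * n) b"
      and \<phi>: "alternating_matrix (ring_at R m) (2 * n) \<phi>"
        "form_matrix (ring_at R m) (module_at R m P) (form_at R m B) (2 * n) b \<phi>"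
        "pfaffian (ring_at R m) n \<phi> = \<one>\<^bsub>ring_at R m\<^esub>"
      by blast
    then have "b \<in> {..<2 * n} \<rightarrow> carrier (module_at R m P)" by (simp add: module_basis_def)
    from ex_form_value_notin_prime[OF \<open>cring R\<close> P bilinear R.maximalideal_prime[OF m] this \<phi> \<open>n \<ge> 1\<close>]
    show "\<exists>x\<in>carrier P. \<exists>y\<in>carrier P. B x y \<notin> m" .
  qed
qed

end
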